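(* Let $\bar x\in\mathbb{R}^n$, $r>0$, $X=\mathbb{B}(\bar x,r)$, and let $f:X\to\mathbb{R}$ be continuously differentiable with $\|\nabla f(x)-\nabla f(y)\|\le L\|x-y\|$ for all $x,y\in X$, where $L>0$. Let $\bar x$ be a local minimizer of $f$, and let $f$ satisfy the basic PLK condition at $\bar x$ (see context). Let $\{x^k\}$ be the sequence of iterates generated by the inexact gradient descent method with momentum (IGDm, see context) with this $X$, with parameters $\nu\in(0,1)$ and $\{\beta_k\},\{\gamma_k\}\subset[0,\infty)$ such that $\bar\beta:=\sup_k\beta_k\in[0,\sqrt{1-\nu})$ and $\bar\delta:=\sup_k|\beta_k-\gamma_k|<\infty$, and assume that $\nabla f(x^k_{\rm ex})\ne0$ for all $k\in\mathbb{N}$. Then there exist $\xi\in(0,r]$ and $T>0$ such that for any initial point $x^0=x^1\in\mathbb{B}(\bar x,\xi)$ and any $\tau\in(0,T]$ we have the following convergence properties. (i) The sequences $\{x^k\},\{x^k_{\rm in}\},\{x^k_{\rm ex}\}$ stay in $\mathbb{B}(\bar x,r)$ and converge to some local minimizer $\tilde x\in\mathbb{B}(\bar x,r)$ of $f$ with $f(\tilde x)=f(\bar x)$. (ii) If the exponential PLK condition is satisfied, i.e., $f$ satisfies the PLK condition at $\bar x$ with the desingularizing function $\psi(t)=Mt^{1-q}$ for some $M>0$ and $q\in(0,1)$, then the following convergence rates are guaranteed as $k\to\infty$: - for $q=1/2$, the sequences $\{x^k\},\{\nabla f(x^k)\},\{f(x^k)\}$ converge linearly to $\tilde x$, $0$,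 $f(\tilde x)$, respectively; - for $q\in(1/2,1)$, $$\|x^k-\tilde x\|=\mathcal{O}\big(k^{-\frac{1-q}{2q-1}}\big),\quad \|\nabla f(x^k)\|=\mathcal{O}\big(k^{-\frac{1-q}{2q-1}}\big),\quad f(x^k)-f(\tilde x)=\mathcal{O}\big(k^{-\frac{2-2q}{2q-1}}\big).$$
   Context: $\|\cdot\|$ is the Euclidean norm on $\mathbb{R}^n$, $\mathbb{B}(\bar x,r)$ is the open ball centered at $\bar x$ with radius $r$, and $\mathbb{N}=\{1,2,\dots\}$. IGDm for minimizing $f$: choose $x^0=x^1\in X$, $\{\beta_k\},\{\gamma_k\}\subset[0,\infty)$, $\nu\in(0,1)$, $\tau>0$ with $\bar\beta:=\sup_k\beta_k<1$ and $\bar\delta:=\sup_k|\beta_k-\gamma_k|<\infty$. For each $k\ge1$ put $$x^k_{\rm in}:=x^k+\beta_k(x^k-x^{k-1}),\qquad x^k_{\rm ex}:=x^k+\gamma_k(x^k-x^{k-1}),\qquad x^{k+1}:=x^k_{\rm in}-\tau g^k,$$ where $g^k\in\mathbb{R}^n$ satisfies $\|g^k-\nabla f(x^k_{\rm ex})\|\le\nu\|g^k\|$. PLK (Polyak-Łojasiewicz-Kurdyka) condition: a function $f$ that is continuously differentiable on the open set $X\ni\bar x$ satisfies the (basic) PLK condition at $\bar x$ if there exist $\eta\in(0,\infty]$, a neighborhood $U\subset X$ of $\bar x$, and a concave function $\varphi:[0,\eta)\to[0,\infty)$, called a desingularizing function, such that $\varphi(0)=0$, $\varphi$ is $C^1$-smooth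 on $(0,\eta)$, $\varphi'>0$ on $(0,\eta)$, and $\varphi'(f(x)-f(\bar x))\,\|\nabla f(x)\|\ge1$ for all $x\in U$ with $f(\bar x)<f(x)<f(\bar x)+\eta$. It satisfies the condition with the desingularizing function $\psi$ if one can take $\varphi=\psi$.
   Formalization: The exponent q is fixed before ξ and T are chosen, so ξ and T may depend on q; with ξ and T chosen uniformly for all admissible q, part (ii) fails, e.g. for f(s,t)=|t|^(p+s²), p>2, at the origin. *)

theory Defs
  imports "HOL-Analysis.Analysis" "HOL-Library.Landau_Symbols"
begin

text \<open>Unspecified at points where \<open>f\<close> is not differentiable.\<close>

definition gradient :: "('a::euclidean_space \<Rightarrow> real) \<Rightarrow> 'a \<Rightarrow> 'a" where
  "gradient f x = (THE D. GDERIV f x :> D)"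

lemma gradient_eqI:
  assumes "GDERIV f x :> D"
  shows "gradient f x = D"
  unfolding gradient_def
proof (rule the_equality)
  fix D' assume "GDERIV f x :> D'"
  with assms have "(\<lambda>h. h \<bullet> D') = (\<lambda>h. h \<bullet> D)"
    unfolding gderiv_def by (rule has_derivative_unique[rotated])
  then show "D' = D"
    by (metis vector_eq_ldot)
qed (rule assms)

definition C1_on :: "('a::euclidean_space \<Rightarrow> real) \<Rightarrow> 'a set \<Rightarrow> bool" where
  "C1_on f X \<longleftrightarrow> (\<forall>x\<in>X. f differentiable (at x)) \<and> continuous_on X (gradient f)"

definition local_minimizer :: "('a::metric_space \<Rightarrow> real) \<Rightarrow> 'a set \<Rightarrow> 'a \<Rightarrow> bool" where
  "local_minimizer f X x \<longleftrightarrow> x \<in> X \<and> (\<exists>e>0. \<forall>y\<in>X \<inter> ball x e. f x \<le> f y)"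

text \<open>\<open>\<eta>\<close> is an extended real because \<open>\<eta> = \<infinity>\<close> is allowed. No continuity of \<open>\<phi>\<close> at \<open>0\<close> is
  demanded beyond what concavity gives.\<close>

definition desingularizing :: "ereal \<Rightarrow> (real \<Rightarrow> real) \<Rightarrow> bool" where
  "desingularizing \<eta> \<phi> \<longleftrightarrow>
     concave_on {t. 0 \<le> t \<and> ereal t < \<eta>} \<phi> \<and>
     (\<forall>t. 0 \<le> t \<and> ereal t < \<eta> \<longrightarrow> 0 \<le> \<phi> t) \<and>
     \<phi> 0 = 0 \<and>
     (\<forall>t. 0 < t \<and> ereal t < \<eta> \<longrightarrow> \<phi> differentiable (at t)) \<and>
     continuous_on {t. 0 < t \<and> ereal t < \<eta>} (deriv \<phi>) \<and>
     (\<forall>t. 0 < t \<and> ereal t < \<eta> \<longrightarrow> 0 < deriv \<phi> t)"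

definition PLK_with ::
  "('a::euclidean_space \<Rightarrow> real) \<Rightarrow> 'a set \<Rightarrow> 'a \<Rightarrow> (real \<Rightarrow> real) \<Rightarrow> bool" where
  "PLK_with f X xbar \<phi> \<longleftrightarrow>
     (\<exists>\<eta>::ereal. \<exists>U. 0 < \<eta> \<and> xbar \<in> interior U \<and> U \<subseteq> X \<and> desingularizing \<eta> \<phi> \<and>
        (\<forall>x\<in>U. f xbar < f x \<and> ereal (f x) < ereal (f xbar) + \<eta> \<longrightarrow>
            1 \<le> deriv \<phi> (f x - f xbar) * norm (gradient f x)))"

definition PLK :: "('a::euclidean_space \<Rightarrow> real) \<Rightarrow> 'a set \<Rightarrow> 'a \<Rightarrow> bool" where
  "PLK f X xbar \<longleftrightarrow> (\<exists>\<phi>. PLK_with f X xbar \<phi>)"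

definition exponential_PLK ::
  "('a::euclidean_space \<Rightarrow> real) \<Rightarrow> 'a set \<Rightarrow> 'a \<Rightarrow> real \<Rightarrow> bool" where
  "exponential_PLK f X xbar q \<longleftrightarrow>
     (\<exists>M>0. PLK_with f X xbar (\<lambda>t. M * t powr (1 - q)))"

text \<open>\<open>momentum_point \<beta> x\<close> is the sequence \<open>x_in\<close> and \<open>momentum_point \<gamma> x\<close> the sequence \<open>x_ex\<close>;
  both are meant for \<open>k \<ge> 1\<close> only.\<close>

definition momentum_point ::
  "(nat \<Rightarrow> real) \<Rightarrow> (nat \<Rightarrow> 'a::real_vector) \<Rightarrow> nat \<Rightarrow> 'a" where
  "momentum_point a x k = x k + a k *\<^sub>R (x k - x (k - 1))"

text \<open>\<open>f\<close> is only given on \<open>X\<close>, so the requirement on \<open>g\<^sup>k\<close> is imposed only when the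
  extrapolated point lies in \<open>X\<close>; whether it does is not part of the method.\<close>

definition IGDm ::
  "('a::euclidean_space \<Rightarrow> real) \<Rightarrow> 'a set \<Rightarrow> (nat \<Rightarrow> real) \<Rightarrow> (nat \<Rightarrow> real) \<Rightarrow> real \<Rightarrow> real \<Rightarrow>
    (nat \<Rightarrow> 'a) \<Rightarrow> bool" where
  "IGDm f X \<beta> \<gamma> \<nu> \<tau> x \<longleftrightarrow>
     x 0 \<in> X \<and> x 1 = x 0 \<and>
     (\<exists>g. \<forall>k\<ge>1.
        x (k + 1) = momentum_point \<beta> x k - \<tau> *\<^sub>R g k \<and>
        (momentum_point \<gamma> x k \<in> X \<longrightarrow>
           norm (g k - gradient f (momentum_point \<gamma> x k)) \<le> \<nu> * norm (g k)))"

text \<open>Linear convergence is understood in the root sense: the error is dominated by a geometric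
  sequence. Iterates with momentum need not decrease the error monotonically.\<close>

definition converges_linearly :: "(nat \<Rightarrow> 'a::metric_space) \<Rightarrow> 'a \<Rightarrow> bool" where
  "converges_linearly s l \<longleftrightarrow>
     (\<exists>c>0. \<exists>\<rho>. 0 < \<rho> \<and> \<rho> < 1 \<and> (\<forall>k. dist (s k) l \<le> c * \<rho> ^ k))"

end

theory Submission
  imports Defs
begin

text \<open>With \<open>d\<^sub>k = x\<^sub>k - x\<^sub>k\<^sub>-\<^sub>1\<close>, the Lyapunov value
  \<open>H\<^sub>k = f(x\<^sub>k) - f(xbar) + c / (2\<tau>) |d\<^sub>k|\<^sup>2\<close> with \<open>c\<close> halfway between \<open>B\<^sup>2\<close> and \<open>1 - \<nu>\<close> decreases by
  at least a multiple of \<open>(|d\<^sub>k| + |d\<^sub>k\<^sub>+\<^sub>1|)\<^sup>2 / \<tau>\<close> for small \<open>\<tau>\<close>, while the gradient at \<open>x\<^sub>k\<close> is at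
  most a multiple of \<open>(|d\<^sub>k| + |d\<^sub>k\<^sub>+\<^sub>1|) / \<tau>\<close>. The PLK inequality therefore makes the potential
  \<open>\<phi>(H\<^sub>k / 2) + sqrt H\<^sub>k\<close> decrease by at least a multiple of \<open>|d\<^sub>k| + |d\<^sub>k\<^sub>+\<^sub>1|\<close>, uniformly in \<open>\<tau>\<close>. Summing up,
  the trajectory has small length if it starts near \<open>xbar\<close>, so it stays in the neighbourhood and
  converges, and the remaining length is bounded by the current potential. In the exponential case
  \<open>H\<^sub>k\<^sub>+\<^sub>1 \<le> H\<^sub>k - C H\<^sub>k powr (2q)\<close>, which gives the rates.\<close>

section \<open>Gradients\<close>

text \<open>The candidate gradient collects the coefficients \<open>D b\<close> in the orthonormal
  basis (Riesz representation).\<close>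

lemma gderiv_gradient:
  fixes f :: "'a::euclidean_space \<Rightarrow> real"
  assumes "f differentiable (at x)"
  shows "GDERIV f x :> gradient f x"
proof -
  obtain D where D: "(f has_derivative D) (at x)"
    using assms by (auto simp: differentiable_def)
  then interpret D: linear D by (rule has_derivative_linear)
  have "D h = h \<bullet> (\<Sum>b\<in>Basis. D b *\<^sub>R b)" for h
  proof -
    have "D h = D (\<Sum>b\<in>Basis. (h \<bullet> b) *\<^sub>R b)" by (simp add: euclidean_representation)
    also have "\<dots> = h \<bullet> (\<Sum>b\<in>Basis. D b *\<^sub>R b)"
      by (simp add: D.sum D.scale inner_sum_right mult.commute)
    finally show ?thesis .
  qed
  then have "D = (\<lambda>h. h \<bullet> (\<Sum>b\<in>Basis. D b *\<^sub>R b))" by (rule ext)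
  then have "GDERIV f x :> (\<Sum>b\<in>Basis. D b *\<^sub>R b)"
    using D by (simp add: gderiv_def)
  then show ?thesis by (simp add: gradient_eqI)
qed

lemma gradient_zero_at_interior_min:
  fixes f :: "'a::euclidean_space \<Rightarrow> real"
  assumes "f differentiable (at x)" "open S" "x \<in> S" "\<And>y. y \<in> S \<Longrightarrow> f x \<le> f y"
  shows "gradient f x = 0"
proof -
  have "(\<lambda>h. h \<bullet> gradient f x) = (\<lambda>h. 0)"
    using differential_zero_maxmin[OF assms(3,2)] gderiv_gradient[OF assms(1)] assms(4)
    unfolding gderiv_def by blast
  then show ?thesis by (metis inner_eq_zero_iff)
qed

text \<open>Mean value theorem on the segment: the gradient at one intermediate point differs from
  that at \<open>x\<close> by at most \<open>L * norm e\<close>. The constant \<open>L\<close> in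
  place of \<open>L / 2\<close> is harmless, since this term is later absorbed by a small step
  size.\<close>

lemma Lipschitz_gradient_upper_bound:
  fixes f :: "'a::euclidean_space \<Rightarrow> real"
  assumes "convex S" and diff: "\<And>x. x \<in> S \<Longrightarrow> f differentiable (at x)"
    and lip: "\<And>x y. x \<in> S \<Longrightarrow> y \<in> S \<Longrightarrow> norm (gradient f x - gradient f y) \<le> L * norm (x - y)"
    and "0 \<le> L" "x \<in> S" "x + e \<in> S"
  shows "f (x + e) \<le> f x + gradient f x \<bullet> e + L * (norm e)\<^sup>2"
proof -
  have S: "x + t *\<^sub>R e \<in> S" if "0 \<le> t" "t \<le> 1" for t
    using convexD_alt[OF \<open>convex S\<close> \<open>x \<in> S\<close> \<open>x + e \<in> S\<close> that]
    by (simp add: algebra_simps)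
  have "((\<lambda>t. f (x + t *\<^sub>R e)) has_derivative (\<lambda>h. (h *\<^sub>R e) \<bullet> gradient f (x + t *\<^sub>R e)))
      (at t within {0..1})" if "0 \<le> t" "t \<le> 1" for t
  proof -
    have "((\<lambda>t. x + t *\<^sub>R e) has_derivative (\<lambda>h. h *\<^sub>R e)) (at t within {0..1})"
      by (auto intro!: derivative_eq_intros)
    from has_derivative_compose[OF this gderiv_gradient[OF diff[OF S[OF that]], unfolded gderiv_def]]
    show ?thesis .
  qed
  from mvt_very_simple[OF zero_le_one this]
  obtain t where t: "0 \<le> t" "t \<le> 1" and eq: "f (x + e) - f x = e \<bullet> gradient f (x + t *\<^sub>R e)"
    by auto
  have "(gradient f (x + t *\<^sub>R e) - gradient f x) \<bullet> e
      \<le> norm (gradient f (x + t *\<^sub>R e) - gradient f x) * norm e"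
    by (rule norm_cauchy_schwarz)
  also have "\<dots> \<le> (L * norm (t *\<^sub>R e)) * norm e"
    using lip[OF S[OF t] \<open>x \<in> S\<close>] by (intro mult_right_mono) auto
  also have "\<dots> \<le> L * (norm e)\<^sup>2"
  proof -
    have "t * (L * (norm e)\<^sup>2) \<le> 1 * (L * (norm e)\<^sup>2)"
      using t \<open>0 \<le> L\<close> by (intro mult_right_mono) auto
    then show ?thesis using t by (simp add: power2_eq_square ac_simps)
  qed
  finally show ?thesis using eq by (simp add: inner_diff_left inner_commute[of e])
qed

text \<open>Splitting \<open>G = g + (G - g)\<close> and replacing \<open>g\<close> by the two
  displacements leaves the cross term \<open>b * (d \<bullet> e)\<close> with factor
  \<open>1 - \<nu>\<close>; Young's inequality removes it. The coefficients \<open>b\<^sup>2\<close>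
  and \<open>1 - \<nu>\<close> are the origin of the threshold \<open>sqrt (1 - \<nu>)\<close> for
  \<open>\<beta>\<close>.\<close>

lemma inexact_momentum_inner_bound:
  fixes d e g G :: "'a::real_inner"
  assumes "0 < \<tau>" "0 \<le> \<nu>" "\<nu> \<le> 1" and g: "\<tau> *\<^sub>R g = b *\<^sub>R d - e"
    and err: "norm (g - G) \<le> \<nu> * norm g"
  shows "G \<bullet> e \<le> (b\<^sup>2 * (norm d)\<^sup>2 - (1 - \<nu>) * (norm e)\<^sup>2) / (2 * \<tau>)"
proof -
  let ?u = "b *\<^sub>R d - e"
  have nu: "norm ?u = \<tau> * norm g" using g[symmetric] \<open>0 < \<tau>\<close> by simp
  have norm_u: "(norm ?u)\<^sup>2 = b\<^sup>2 * (norm d)\<^sup>2 - 2 * (b * (d \<bullet> e)) + (norm e)\<^sup>2"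
    unfolding power2_norm_eq_inner
    by (simp add: inner_diff inner_commute[of e d] power2_eq_square algebra_simps)
  have "(G - g) \<bullet> e \<le> norm (g - G) * norm e"
    using norm_cauchy_schwarz[of "G - g" e] by (simp add: norm_minus_commute)
  also have "\<dots> \<le> (\<nu> * norm g) * norm e" by (intro mult_right_mono err) auto
  finally have "\<tau> * ((G - g) \<bullet> e) \<le> \<tau> * ((\<nu> * norm g) * norm e)"
    using \<open>0 < \<tau>\<close> by (intro mult_left_mono) auto
  also have "\<dots> = \<nu> * (norm ?u * norm e)" unfolding nu by (simp add: ac_simps)
  also have "\<dots> \<le> \<nu> * (((norm ?u)\<^sup>2 + (norm e)\<^sup>2) / 2)"
    using sum_squares_bound[of "norm ?u" "norm e"] \<open>0 \<le> \<nu>\<close> by (intro mult_left_mono) auto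
  also have "\<dots> = \<nu> / 2 * (b\<^sup>2 * (norm d)\<^sup>2) - \<nu> * (b * (d \<bullet> e)) + \<nu> * (norm e)\<^sup>2"
    unfolding norm_u by (simp add: field_simps)
  finally have 1: "\<tau> * ((G - g) \<bullet> e)
      \<le> \<nu> / 2 * (b\<^sup>2 * (norm d)\<^sup>2) - \<nu> * (b * (d \<bullet> e)) + \<nu> * (norm e)\<^sup>2" .
  have "\<tau> * (g \<bullet> e) = ?u \<bullet> e" by (metis g inner_scaleR_left)
  also have "\<dots> = b * (d \<bullet> e) - (norm e)\<^sup>2" by (simp add: inner_diff power2_norm_eq_inner)
  finally have 2: "\<tau> * (g \<bullet> e) = b * (d \<bullet> e) - (norm e)\<^sup>2" .
  have "0 \<le> (norm ?u)\<^sup>2" by simp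
  also note norm_u
  finally have "b * (d \<bullet> e) \<le> (b\<^sup>2 * (norm d)\<^sup>2 + (norm e)\<^sup>2) / 2" by simp
  then have 3: "(1 - \<nu>) * (b * (d \<bullet> e)) \<le> (1 - \<nu>) * ((b\<^sup>2 * (norm d)\<^sup>2 + (norm e)\<^sup>2) / 2)"
    using \<open>\<nu> \<le> 1\<close> by (intro mult_left_mono) auto
  have "\<tau> * (G \<bullet> e) = \<tau> * (g \<bullet> e) + \<tau> * ((G - g) \<bullet> e)"
    by (simp add: inner_diff_left right_diff_distrib)
  also have "\<dots> \<le> (b\<^sup>2 * (norm d)\<^sup>2 - (1 - \<nu>) * (norm e)\<^sup>2) / 2"
    using 1 2 3 by (simp add: left_diff_distrib right_diff_distrib distrib_left
        add_divide_distrib diff_divide_distrib)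
  finally show ?thesis using \<open>0 < \<tau>\<close> by (simp add: pos_le_divide_eq ac_simps)
qed

section \<open>Desingularizing functions\<close>

lemma ereal_le_less_trans: "x \<le> y \<Longrightarrow> ereal y < \<eta> \<Longrightarrow> ereal x < \<eta>"
  by (erule order.strict_trans1[rotated]) simp

lemma desingularizing_tangent:
  assumes "desingularizing \<eta> \<phi>" "0 < s" "ereal s < \<eta>" "0 \<le> t" "ereal t < \<eta>"
  shows "\<phi> t \<le> \<phi> s + deriv \<phi> s * (t - s)"
proof -
  let ?A = "{t. 0 \<le> t \<and> ereal t < \<eta>}"
  have "is_interval ?A" unfolding is_interval_1
    by (auto intro: ereal_le_less_trans)
  moreover have "s \<in> interior ?A"
  proof -
    \<comment> \<open>An endpoint strictly between \<open>s\<close> and \<open>\<eta>\<close>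
      handles finite and infinite \<open>\<eta>\<close> alike.\<close>
    obtain s' where s': "ereal s < ereal s'" "ereal s' < \<eta>"
      using ereal_dense2[OF assms(3)] by auto
    have "{0<..<s'} \<subseteq> ?A" using s' by (auto intro: ereal_le_less_trans[of _ s'])
    then show ?thesis using s' \<open>0 < s\<close> by (intro interiorI[of "{0<..<s'}"]) auto
  qed
  moreover have "convex_on ?A (\<lambda>t. - \<phi> t)" and "\<phi> differentiable (at s)"
    using assms by (auto simp: desingularizing_def concave_on_def)
  moreover from this(2) have "((\<lambda>t. - \<phi> t) has_real_derivative - deriv \<phi> s) (at s within ?A)"
    by (auto intro!: derivative_intros intro: has_field_derivative_at_within
        simp flip: DERIV_deriv_iff_real_differentiable)
  ultimately have "- deriv \<phi> s * (t - s) \<le> - \<phi> t - - \<phi> s"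
    using assms by (intro convex_on_imp_above_tangent[of ?A]) (auto simp: is_interval_connected)
  then show ?thesis by simp
qed

text \<open>Adding the tangent inequalities at \<open>u\<close> and \<open>s\<close> gives
  \<open>deriv \<phi> s \<le> deriv \<phi> u\<close>; the tangent at \<open>u\<close>, evaluated at
  \<open>v\<close>, then bounds the increment. Keeping \<open>s\<close> to the right of
  \<open>u\<close> allows the derivative that PLK controls at the function gap to be used at half
  the Lyapunov value.\<close>

lemma desingularizing_slope:
  assumes "desingularizing \<eta> \<phi>" "0 < v" "v \<le> u" "u \<le> s" "ereal s < \<eta>"
  shows "deriv \<phi> s * (u - v) \<le> \<phi> u - \<phi> v"
proof -
  have u: "ereal u < \<eta>" "0 < u" using assms by (auto intro: ereal_le_less_trans[of _ s])
  have v: "ereal v < \<eta>" using assms u by (auto intro: ereal_le_less_trans[of _ u])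
  have "\<phi> s \<le> \<phi> u + deriv \<phi> u * (s - u)" "\<phi> u \<le> \<phi> s + deriv \<phi> s * (u - s)"
    "\<phi> v \<le> \<phi> u + deriv \<phi> u * (v - u)"
    using assms u v by (auto intro!: desingularizing_tangent)
  then have *: "0 \<le> (deriv \<phi> u - deriv \<phi> s) * (s - u)" and **: "deriv \<phi> u * (u - v) \<le> \<phi> u - \<phi> v"
    by (auto simp: algebra_simps)
  have "deriv \<phi> s \<le> deriv \<phi> u"
    using * \<open>u \<le> s\<close> by (cases "u = s") (auto simp: zero_le_mult_iff)
  then have "deriv \<phi> s * (u - v) \<le> deriv \<phi> u * (u - v)"
    using \<open>v \<le> u\<close> by (intro mult_right_mono) auto
  then show ?thesis using ** by linarith
qed

text \<open>A desingularizing function may jump at \<open>0\<close>, so only its oscillation to the right of \<open>0\<close>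
  is small.\<close>

lemma desingularizing_small_oscillation:
  assumes "desingularizing \<eta> \<phi>" "0 < \<eta>" "0 < e"
  obtains t where "0 < t" "ereal t < \<eta>" "\<And>v u. 0 < v \<Longrightarrow> v \<le> u \<Longrightarrow> u \<le> t \<Longrightarrow> \<phi> u - \<phi> v \<le> e"
proof -
  let ?S = "{t. 0 < t \<and> ereal t < \<eta>}"
  have "?S \<noteq> {}" using ereal_dense2[OF assms(2)] by auto
  moreover have bdd: "bdd_below (\<phi> ` ?S)"
    using assms(1) by (intro bdd_belowI[of _ 0]) (auto simp: desingularizing_def)
  \<comment> \<open>\<open>\<phi>\<close> increases on positive arguments, so a \<open>t\<close>
    whose value nearly attains the infimum bounds the oscillation on all positive arguments up to
    \<open>t\<close>.\<close>
  ultimately obtain t where t: "t \<in> ?S" "\<phi> t < Inf (\<phi> ` ?S) + e"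
    using cInf_less_iff[of "\<phi> ` ?S" "Inf (\<phi> ` ?S) + e"] \<open>0 < e\<close> by auto
  show ?thesis
  proof
    show "0 < t" "ereal t < \<eta>" using t by auto
    fix v u :: real assume vu: "0 < v" "v \<le> u" "u \<le> t"
    have v: "v \<in> ?S" using vu t by (auto intro: ereal_le_less_trans[of _ t])
    have "0 \<le> deriv \<phi> t * (t - u)"
      using assms(1) t vu by (auto simp: desingularizing_def less_imp_le)
    also have "\<dots> \<le> \<phi> t - \<phi> u"
      using assms(1) t vu by (intro desingularizing_slope) auto
    finally show "\<phi> u - \<phi> v \<le> e"
      using t(2) cInf_lower[OF imageI[OF v, of \<phi>] bdd] by linarith
  qed
qed

section \<open>Rates from recursive inequalities\<close>

text \<open>The powers \<open>y k = E k powr - \<alpha>\<close> grow at least linearly: each step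
  adds \<open>\<alpha> * c\<close>, by
  \<open>(1 - z) powr - \<alpha> \<ge> 1 + \<alpha> * z\<close>. Inverting the power gives the
  rate.\<close>

lemma power_recursion_rate:
  fixes E :: "nat \<Rightarrow> real"
  assumes pos: "\<And>k. k \<ge> 1 \<Longrightarrow> 0 < E k" and "0 < \<alpha>" "0 < c"
    and rec: "\<And>k. k \<ge> 1 \<Longrightarrow> E (k + 1) \<le> E k - c * E k powr (1 + \<alpha>)"
  obtains C where "0 < C" "\<And>k. k \<ge> 1 \<Longrightarrow> E k \<le> C * real k powr - (1 / \<alpha>)"
proof -
  define y where "y k = E k powr - \<alpha>" for k
  \<comment> \<open>The minimum covers both the start \<open>k = 1\<close> and the increment in the
    induction for \<open>m * real k \<le> y k\<close>.\<close>
  define m where "m = min (y 1) (\<alpha> * c)"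
  have step: "y k + \<alpha> * c \<le> y (k + 1)" if k: "k \<ge> 1" for k
  proof -
    define z where "z = c * E k powr \<alpha>"
    have E: "0 < E k" "0 < E (k + 1)" using pos k by auto
    have le: "E (k + 1) \<le> E k * (1 - z)"
      using rec[OF k] E by (simp add: z_def powr_add algebra_simps)
    \<comment> \<open>Positivity of \<open>E (k + 1)\<close> keeps the factor \<open>1 - z\<close>
      positive, so that it may be raised to a negative power.\<close>
    have z1: "z < 1"
      using less_le_trans[OF E(2) le] E(1) by (simp add: zero_less_mult_iff)
    have "1 + \<alpha> * z \<le> exp (\<alpha> * z)" by (rule exp_ge_add_one_self)
    also have "\<dots> \<le> exp (\<alpha> * - ln (1 - z))"
      using ln_le_minus_one[of "1 - z"] z1 \<open>0 < \<alpha>\<close> unfolding exp_le_cancel_iff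
      by (intro mult_left_mono) auto
    also have "\<dots> = (1 - z) powr - \<alpha>" using z1 by (simp add: powr_def)
    finally have "y k * (1 + \<alpha> * z) \<le> y k * (1 - z) powr - \<alpha>"
      by (intro mult_left_mono) (auto simp: y_def)
    also have "\<dots> = (E k * (1 - z)) powr - \<alpha>"
      using E z1 by (simp add: y_def powr_mult)
    also have "\<dots> \<le> y (k + 1)"
      unfolding y_def using le E \<open>0 < \<alpha>\<close> by (intro powr_mono2') auto
    finally have "y k + \<alpha> * (y k * z) \<le> y (k + 1)" by (simp add: algebra_simps)
    moreover have "y k * z = c" using E by (simp add: y_def z_def powr_minus)
    ultimately show ?thesis by simp
  qed
  have "0 < m" using \<open>0 < \<alpha>\<close> \<open>0 < c\<close> pos[of 1] by (simp add: m_def y_def)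
  have y_ge: "m * real k \<le> y k" if "k \<ge> 1" for k
    using that
  proof (induction k rule: dec_induct)
    case base
    then show ?case by (simp add: m_def)
  next
    case (step k)
    then have "m * real (Suc k) \<le> y k + \<alpha> * c"
      by (simp add: m_def algebra_simps)
    then show ?case using \<open>\<And>k. k \<ge> 1 \<Longrightarrow> y k + \<alpha> * c \<le> y (k + 1)\<close>[of k] step by simp
  qed
  show ?thesis
  proof
    show "0 < m powr - (1 / \<alpha>)" using \<open>0 < m\<close> by simp
    fix k :: nat assume k: "k \<ge> 1"
    have "E k = y k powr - (1 / \<alpha>)"
      using pos[OF k] \<open>0 < \<alpha>\<close> by (simp add: y_def powr_powr)
    also have "\<dots> \<le> (m * real k) powr - (1 / \<alpha>)"
      using y_ge[OF k] \<open>0 < m\<close> k \<open>0 < \<alpha>\<close> by (intro powr_mono2') auto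
    finally show "E k \<le> m powr - (1 / \<alpha>) * real k powr - (1 / \<alpha>)"
      using \<open>0 < m\<close> by (simp add: powr_mult)
  qed
qed

lemma geometric_recursion_rate:
  fixes E :: "nat \<Rightarrow> real"
  assumes pos: "\<And>k. k \<ge> 1 \<Longrightarrow> 0 < E k" and "0 < c"
    and rec: "\<And>k. k \<ge> 1 \<Longrightarrow> E (k + 1) \<le> E k - c * E k"
  obtains C \<rho> where "0 < C" "0 < \<rho>" "\<rho> < 1" "\<And>k. k \<ge> 1 \<Longrightarrow> E k \<le> C * \<rho> ^ k"
proof -
  \<comment> \<open>Positivity of \<open>E 2\<close> forces \<open>c < 1\<close>, which makes
    \<open>1 - c\<close> an admissible ratio.\<close>
  have "0 < (1 - c) * E 1" using rec[of 1] pos[of "1 + 1"] by (simp add: left_diff_distrib)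
  then have c: "0 < 1 - c" using pos[of 1] by (simp add: zero_less_mult_iff)
  have "E k \<le> E 1 / (1 - c) * (1 - c) ^ k" if "k \<ge> 1" for k
    using that
  proof (induction k rule: dec_induct)
    case base
    then show ?case using c by simp
  next
    case (step k)
    have "E (Suc k) \<le> (1 - c) * E k" using rec[of k] step by (simp add: algebra_simps)
    also have "\<dots> \<le> (1 - c) * (E 1 / (1 - c) * (1 - c) ^ k)"
      using step c by (intro mult_left_mono) auto
    finally show ?case by (simp add: mult.left_commute)
  qed
  then show ?thesis using that[of "E 1 / (1 - c)" "1 - c"] c \<open>0 < c\<close> pos[of 1] by simp
qed

lemma converges_linearlyI:
  fixes s :: "nat \<Rightarrow> 'a::metric_space"
  assumes "0 < C" "0 < \<rho>" "\<rho> < 1" and le: "\<And>k. k \<ge> 1 \<Longrightarrow> dist (s k) l \<le> C * \<rho> ^ k"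
  shows "converges_linearly s l"
proof -
  \<comment> \<open>The summand \<open>dist (s 0) l\<close> takes care of \<open>k = 0\<close>,
    where the hypothesis is silent and the power is 1.\<close>
  have "dist (s k) l \<le> (C + dist (s 0) l) * \<rho> ^ k" for k
  proof (cases "k \<ge> 1")
    case True
    have "C * \<rho> ^ k \<le> (C + dist (s 0) l) * \<rho> ^ k"
      using \<open>0 < \<rho>\<close> by (intro mult_right_mono) auto
    then show ?thesis using le[OF True] by linarith
  qed (use \<open>0 < C\<close> in \<open>auto simp: not_less_eq_eq\<close>)
  then show ?thesis
    using assms unfolding converges_linearly_def
    by (intro exI[of _ "C + dist (s 0) l"] exI[of _ \<rho>] conjI allI) (auto intro: add_pos_nonneg)
qed

text \<open>Telescoping bounds \<open>dist (x m) (x k)\<close> by \<open>y k - y m\<close>, and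
  \<open>y\<close>, being decreasing and bounded below, is Cauchy. The \<open>l\<close> in the
  conclusion is quantified anew, so the error estimate is available with every lower bound of
  \<open>y\<close>.\<close>

lemma converges_if_steps_telescope:
  fixes x :: "nat \<Rightarrow> 'a::complete_space"
  assumes step: "\<And>k. dist (x (Suc k)) (x k) \<le> y k - y (Suc k)" and bdd: "\<And>k. l \<le> y k"
  obtains z where "x \<longlonglongrightarrow> z" "\<And>l k. (\<And>k. l \<le> y k) \<Longrightarrow> dist (x k) z \<le> y k - l"
proof -
  have tele: "dist (x m) (x k) \<le> y k - y m" if "k \<le> m" for k m
    using that
  proof (induction m rule: dec_induct)
    case (step m)
    then show ?case using assms(1)[of m] dist_triangle[of "x (Suc m)" "x k" "x m"] by linarith
  qed simp
  have "decseq y"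
    using order_trans[OF zero_le_dist step] by (intro decseq_SucI) simp
  then obtain Y where "y \<longlonglongrightarrow> Y"
    using decseq_convergent bdd by metis
  then have "Cauchy y" by (rule LIMSEQ_imp_Cauchy)
  have "Cauchy x"
  proof (rule metric_CauchyI)
    fix e :: real assume "0 < e"
    then obtain N where N: "\<And>m k. m \<ge> N \<Longrightarrow> k \<ge> N \<Longrightarrow> dist (y m) (y k) < e"
      using metric_CauchyD[OF \<open>Cauchy y\<close>] by blast
    have "dist (x m) (x k) < e" if "N \<le> k" "k \<le> m" for m k
      using tele[OF that(2)] N[of k m] that by (auto simp: dist_real_def)
    then show "\<exists>N. \<forall>m\<ge>N. \<forall>k\<ge>N. dist (x m) (x k) < e"
      by (metis dist_commute nle_le)
  qed
  then obtain z where z: "x \<longlonglongrightarrow> z" using Cauchy_convergent convergent_def by blast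
  have "dist (x k) z \<le> y k - l" if l: "\<And>k. l \<le> y k" for l k
  proof -
    have "(\<lambda>m. dist (x m) (x k)) \<longlonglongrightarrow> dist z (x k)" by (intro tendsto_intros z)
    moreover have "dist (x m) (x k) \<le> y k - l" if "m \<ge> k" for m using tele[OF that] l[of m] by linarith
    ultimately have "dist z (x k) \<le> y k - l" by (intro LIMSEQ_le_const2) auto
    then show ?thesis by (simp add: dist_commute)
  qed
  with z show ?thesis by (rule that)
qed

section \<open>The potential\<close>

text \<open>The gradient is controlled by \<open>\<phi>\<close> at \<open>s = f x - f xbar\<close>, whereas the Lyapunov value \<open>E\<close>
  exceeds \<open>s\<close> by the kinetic term. If \<open>E \<le> 2 s\<close>, monotonicity of the derivative of \<open>\<phi>\<close> allows
  passing to the argument \<open>E / 2\<close>; otherwise the kinetic term dominates and \<open>sqrt\<close> compensates.\<close>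

definition potential :: "(real \<Rightarrow> real) \<Rightarrow> real \<Rightarrow> real" where
  "potential \<phi> t = \<phi> (t / 2) + sqrt t"

text \<open>Here \<open>w\<close> is a step length, and \<open>\<tau>\<close> cancels in both cases.
  In the first alternative, multiplying the bound on \<open>\<tau>\<close> by \<open>a * w\<close>
  and inserting \<open>dec\<close> yields an increment of \<open>\<phi>\<close>; in the second,
  \<open>E - E'\<close> is factored into square roots and one \<open>w\<close> is cancelled.\<close>

lemma potential_decrease:
  assumes slope: "\<And>v u s. 0 < v \<Longrightarrow> v \<le> u \<Longrightarrow> u \<le> s \<Longrightarrow> s \<le> t \<Longrightarrow> \<phi>' s * (u - v) \<le> \<phi> u - \<phi> v"
    and mono: "\<And>v u. 0 < v \<Longrightarrow> v \<le> u \<Longrightarrow> u \<le> t \<Longrightarrow> \<phi> v \<le> \<phi> u"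
    and E: "0 < E'" "E \<le> t" and "0 < \<tau>" "\<tau> \<le> 1" "0 < a" "1 \<le> K" "0 \<le> w"
    and dec: "a * w\<^sup>2 \<le> 2 * \<tau> * (E - E')"
    and alt: "(\<exists>s. E \<le> 2 * s \<and> s \<le> E \<and> \<tau> \<le> \<phi>' s * (K * w)) \<or> \<tau> * E \<le> w\<^sup>2"
  shows "a * w \<le> 4 * K * (potential \<phi> E - potential \<phi> E')"
proof -
  have "0 \<le> a * w\<^sup>2" using \<open>0 < a\<close> by simp
  then have "E' \<le> E" using dec \<open>0 < \<tau>\<close> by (smt (verit) mult_pos_neg)
  then have \<phi>: "\<phi> (E' / 2) \<le> \<phi> (E / 2)" and sq: "sqrt E' \<le> sqrt E"
    using E by (auto intro!: mono)
  show ?thesis using alt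
  proof
    assume "\<exists>s. E \<le> 2 * s \<and> s \<le> E \<and> \<tau> \<le> \<phi>' s * (K * w)"
    then obtain s where s: "E \<le> 2 * s" "s \<le> E" "\<tau> \<le> \<phi>' s * (K * w)" by blast
    then have "0 < \<phi>' s * (K * w)" using \<open>0 < \<tau>\<close> by linarith
    moreover have "0 \<le> K * w" using \<open>1 \<le> K\<close> \<open>0 \<le> w\<close> by simp
    ultimately have pos: "0 < \<phi>' s" by (simp add: zero_less_mult_iff)
    have "\<tau> * (a * w) \<le> \<phi>' s * (K * w) * (a * w)"
      using s \<open>0 < a\<close> \<open>0 \<le> w\<close> by (intro mult_right_mono) auto
    also have "\<dots> = K * \<phi>' s * (a * w\<^sup>2)" by (simp add: power2_eq_square)
    also have "\<dots> \<le> K * \<phi>' s * (2 * \<tau> * (E - E'))"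
      using dec pos \<open>1 \<le> K\<close> by (intro mult_left_mono) auto
    also have "\<dots> = \<tau> * (4 * K * (\<phi>' s * (E / 2 - E' / 2)))" by (simp add: field_simps)
    \<comment> \<open>\<open>slope\<close> applies because \<open>E \<le> 2 * s\<close> puts
      \<open>E / 2\<close> to the left of \<open>s\<close>.\<close>
    also have "\<dots> \<le> \<tau> * (4 * K * (\<phi> (E / 2) - \<phi> (E' / 2)))"
      using s E \<open>E' \<le> E\<close> \<open>0 < \<tau>\<close> \<open>1 \<le> K\<close> by (intro mult_left_mono slope) auto
    finally have "a * w \<le> 4 * K * (\<phi> (E / 2) - \<phi> (E' / 2))"
      using \<open>0 < \<tau>\<close> by simp
    also have "\<dots> \<le> 4 * K * (potential \<phi> E - potential \<phi> E')"
      using sq \<open>1 \<le> K\<close> unfolding potential_def by (intro mult_left_mono) auto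
    finally show ?thesis .
  next
    assume *: "\<tau> * E \<le> w\<^sup>2"
    have "0 < E" using E \<open>E' \<le> E\<close> by linarith
    then have "0 < w\<^sup>2" using * \<open>0 < \<tau>\<close> by (smt (verit) mult_pos_pos)
    then have "0 < w" using \<open>0 \<le> w\<close> by (cases "w = 0") auto
    \<comment> \<open>The condition \<open>\<tau> \<le> 1\<close> enters as
      \<open>\<tau> \<le> sqrt \<tau>\<close>.\<close>
    have "\<tau> * sqrt E \<le> sqrt \<tau> * sqrt E"
      using \<open>0 < \<tau>\<close> \<open>\<tau> \<le> 1\<close> \<open>0 < E\<close> by (intro mult_right_mono) (auto simp: real_le_rsqrt power2_eq_square mult_left_le)
    also have "\<dots> \<le> w" using * \<open>0 \<le> w\<close> by (simp add: real_le_lsqrt flip: real_sqrt_mult)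
    finally have w: "\<tau> * sqrt E \<le> w" .
    have "w * (a * w) = a * w\<^sup>2" by (simp add: power2_eq_square)
    also note dec
    also have "2 * \<tau> * (E - E') = 2 * \<tau> * ((sqrt E + sqrt E') * (sqrt E - sqrt E'))"
      using \<open>0 < E\<close> E by (simp add: square_diff_square_factored[symmetric])
    also have "\<dots> \<le> 2 * \<tau> * ((2 * sqrt E) * (sqrt E - sqrt E'))"
      using sq \<open>0 < \<tau>\<close> by (intro mult_left_mono mult_right_mono) auto
    also have "\<dots> = (\<tau> * sqrt E) * (4 * (sqrt E - sqrt E'))" by simp
    also have "\<dots> \<le> w * (4 * (sqrt E - sqrt E'))"
      using sq w by (intro mult_right_mono) auto
    finally have "a * w \<le> 4 * (sqrt E - sqrt E')" using \<open>0 < w\<close> by simp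
    also have "\<dots> \<le> 4 * (potential \<phi> E - potential \<phi> E')"
      using \<phi> sq unfolding potential_def by simp
    also have "\<dots> \<le> 4 * K * (potential \<phi> E - potential \<phi> E')"
      using \<phi> sq \<open>1 \<le> K\<close> unfolding potential_def by (intro mult_right_mono) linarith+
    finally show ?thesis .
  qed
qed

section \<open>A single run of the method\<close>

text \<open>Minimality of \<open>xbar\<close> and the PLK inequality are available on the ball of radius \<open>R\<close>; the
  iterates stay in the smaller ball of radius \<open>\<rho>\<close>, so that the momentum points and the next iterate
  cannot leave the larger one. The Lyapunov values stay below \<open>t\<close>, and \<open>\<epsilon>\<close> limits how much the
  potential can drop in total, hence the length of the trajectory.\<close>

locale igdm_run =
  fixes f :: "'a::euclidean_space \<Rightarrow> real" and xbar :: 'a and \<beta> \<gamma> :: "nat \<Rightarrow> real"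
    and r L \<nu> B \<Gamma> a c K R \<rho> t \<epsilon> \<tau> :: real and \<phi> :: "real \<Rightarrow> real" and x :: "nat \<Rightarrow> 'a"
  assumes diff: "y \<in> ball xbar r \<Longrightarrow> f differentiable (at y)"
    and lip: "y \<in> ball xbar r \<Longrightarrow> z \<in> ball xbar r \<Longrightarrow>
      norm (gradient f y - gradient f z) \<le> L * norm (y - z)"
    and L: "0 < L" and \<nu>: "0 < \<nu>" "\<nu> < 1" and B: "0 \<le> B" "B\<^sup>2 < 1 - \<nu>"
    and \<beta>: "k \<ge> 1 \<Longrightarrow> 0 \<le> \<beta> k" "k \<ge> 1 \<Longrightarrow> \<beta> k \<le> B"
    and \<gamma>: "k \<ge> 1 \<Longrightarrow> 0 \<le> \<gamma> k" "k \<ge> 1 \<Longrightarrow> \<gamma> k \<le> \<Gamma>"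
    and a_def: "a = (1 - \<nu> - B\<^sup>2) / 8" and c_def: "c = (1 - \<nu> + B\<^sup>2) / 2" and K_def: "K = 2 + L * \<Gamma>"
    and \<tau>: "0 < \<tau>" "\<tau> \<le> 1" "\<tau> * (L * (\<Gamma> + 1)) \<le> a"
    and R: "0 < R" "R \<le> r" and \<rho>: "0 < \<rho>" "(4 + 2 * \<Gamma>) * \<rho> \<le> R"
    and min: "y \<in> ball xbar R \<Longrightarrow> f xbar \<le> f y"
    and PLK: "y \<in> ball xbar R \<Longrightarrow> f xbar < f y \<Longrightarrow> f y - f xbar \<le> t \<Longrightarrow>
      1 \<le> deriv \<phi> (f y - f xbar) * norm (gradient f y)"
    and slope: "0 < v \<Longrightarrow> v \<le> u \<Longrightarrow> u \<le> s \<Longrightarrow> s \<le> t \<Longrightarrow> deriv \<phi> s * (u - v) \<le> \<phi> u - \<phi> v"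
    and mono: "0 < v \<Longrightarrow> v \<le> u \<Longrightarrow> u \<le> t \<Longrightarrow> \<phi> v \<le> \<phi> u"
    and osc: "0 < v \<Longrightarrow> v \<le> u \<Longrightarrow> u \<le> t \<Longrightarrow> \<phi> u - \<phi> v \<le> \<epsilon>"
    and \<epsilon>: "0 < \<epsilon>" "sqrt t \<le> \<epsilon>" "16 * K * \<epsilon> \<le> a * \<rho>"
    and x0: "dist xbar (x 0) < \<rho> / 2" "f (x 0) - f xbar \<le> t"
    and IGDm: "IGDm f (ball xbar r) \<beta> \<gamma> \<nu> \<tau> x"
    and grad_nz: "k \<ge> 1 \<Longrightarrow> momentum_point \<gamma> x k \<in> ball xbar r \<Longrightarrow>
      gradient f (momentum_point \<gamma> x k) \<noteq> 0"
begin

lemma a_pos: "0 < a" and c_less: "0 < c" "c < 1" and \<Gamma>: "0 \<le> \<Gamma>" and K: "1 \<le> K"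
  using B \<nu> L \<gamma>[of 1] by (auto simp: a_def c_def K_def add_pos_nonneg)

lemma \<rho>_le: "4 * \<rho> \<le> R"
  using \<rho> mult_nonneg_nonneg[of \<Gamma> \<rho>] \<Gamma> unfolding distrib_right by linarith

lemma B_less: "B < 1"
  using B \<nu> by (smt (verit) one_le_power)

text \<open>At \<open>k = 0\<close> truncated subtraction makes this 0, and at \<open>k = 1\<close>
  it vanishes because \<open>x 1 = x 0\<close>; hence \<open>H 1\<close> has no kinetic
  term.\<close>

definition step :: "nat \<Rightarrow> 'a" where "step k = x k - x (k - 1)"

definition H :: "nat \<Rightarrow> real" where
  "H k = f (x k) - f xbar + c / (2 * \<tau>) * (norm (step k))\<^sup>2"

text \<open>\<open>\<tau> *\<^sub>R g\<close> equals
  \<open>\<beta> k *\<^sub>R step k - step (k + 1)\<close>, so the bound on the gradient involves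
  both steps.\<close>

definition w :: "nat \<Rightarrow> real" where "w k = norm (step k) + norm (step (k + 1))"

lemma w_nonneg: "0 \<le> w k" by (simp add: w_def)

lemma ball_R: "y \<in> ball xbar R \<Longrightarrow> y \<in> ball xbar r"
  using R by auto

lemma f_le_H: "f (x k) - f xbar \<le> H k"
  using \<tau> c_less by (simp add: H_def)

lemma gradient_xbar: "gradient f xbar = 0"
  using R min by (intro gradient_zero_at_interior_min[of _ _ "ball xbar R"] diff) auto

lemma gradient_le:
  assumes "y \<in> ball xbar r"
  shows "norm (gradient f y) \<le> L * dist xbar y"
  using lip[OF assms, of xbar] R by (simp add: gradient_xbar dist_norm norm_minus_commute)

text \<open>If \<open>H k\<close> were not positive, both of its nonnegative parts would vanish: the
  extrapolated point would be \<open>x k\<close>, and \<open>x k\<close> would be a minimizer in the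
  open ball with zero gradient, which \<open>grad_nz\<close> excludes.\<close>

lemma H_pos:
  assumes "k \<ge> 1" "x k \<in> ball xbar R"
  shows "0 < H k"
proof (rule ccontr)
  assume "\<not> 0 < H k"
  moreover have "0 \<le> c / (2 * \<tau>) * (norm (step k))\<^sup>2" using \<tau> c_less by simp
  ultimately have "f (x k) = f xbar" "c / (2 * \<tau>) * (norm (step k))\<^sup>2 = 0"
    using min[OF assms(2)] unfolding H_def by linarith+
  then have "momentum_point \<gamma> x k = x k"
    using \<tau> c_less by (simp add: momentum_point_def step_def)
  moreover have "gradient f (x k) = 0"
    using assms(2) R min \<open>f (x k) = f xbar\<close>
    by (intro gradient_zero_at_interior_min[of _ _ "ball xbar R"] diff ball_R) auto
  ultimately show False using grad_nz[OF assms(1)] ball_R[OF assms(2)] by simp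
qed

section \<open>Estimates for one iteration\<close>

context
  fixes k assumes k: "k \<ge> 1" and near: "dist xbar (x (k - 1)) < \<rho>" "dist xbar (x k) < \<rho>"
begin

lemma norm_step_less: "norm (step k) < 2 * \<rho>"
  using near dist_triangle2[of "x k" "x (k - 1)" xbar] by (simp add: step_def dist_norm norm_minus_commute)

lemma ball_small: "dist xbar y \<le> dist xbar (x k) + C * norm (step k) \<Longrightarrow> 0 \<le> C \<Longrightarrow>
    dist xbar y < (1 + 2 * C) * \<rho>"
  using near norm_step_less mult_left_mono[of "norm (step k)" "2 * \<rho>" C] by (simp add: algebra_simps)

lemma momentum_point_dist:
  assumes "0 \<le> \<alpha> k" "\<alpha> k \<le> C"
  shows "dist xbar (momentum_point \<alpha> x k) < (1 + 2 * C) * \<rho>"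
proof -
  have "dist xbar (momentum_point \<alpha> x k) \<le> dist xbar (x k) + \<alpha> k * norm (step k)"
    using dist_triangle[of xbar "momentum_point \<alpha> x k" "x k"] assms
    by (simp add: momentum_point_def step_def dist_norm)
  also have "\<dots> \<le> dist xbar (x k) + C * norm (step k)"
    using assms by (intro add_left_mono mult_right_mono) auto
  finally show ?thesis using assms by (intro ball_small) auto
qed

lemma ex_dist: "dist xbar (momentum_point \<gamma> x k) < (1 + 2 * \<Gamma>) * \<rho>"
  using \<gamma> k by (intro momentum_point_dist) auto

lemma in_dist: "dist xbar (momentum_point \<beta> x k) < 3 * \<rho>"
  using momentum_point_dist[of \<beta> 1] \<beta>[OF k] B_less by simp

lemma ex_ball: "momentum_point \<gamma> x k \<in> ball xbar r"
  using ex_dist \<rho> R by (simp add: algebra_simps)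

lemma in_ball: "momentum_point \<beta> x k \<in> ball xbar r"
  using in_dist \<rho>_le \<rho> R by simp

lemma x_ball: "x k \<in> ball xbar R"
  using near \<rho>_le \<rho> by simp

text \<open>The method constrains \<open>g\<close> only if the extrapolated point lies in the
  domain, which \<open>ex_ball\<close> guarantees. The second equation rewrites the update in terms
  of the two steps.\<close>

lemma gradient_obtain:
  obtains g where "x (k + 1) = momentum_point \<beta> x k - \<tau> *\<^sub>R g"
    "\<tau> *\<^sub>R g = \<beta> k *\<^sub>R step k - step (k + 1)"
    "norm (g - gradient f (momentum_point \<gamma> x k)) \<le> \<nu> * norm g"
proof -
  obtain g where g: "x (k + 1) = momentum_point \<beta> x k - \<tau> *\<^sub>R g"
      "norm (g - gradient f (momentum_point \<gamma> x k)) \<le> \<nu> * norm g"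
    using IGDm k ex_ball unfolding IGDm_def by metis
  then show ?thesis by (intro that[of g]) (auto simp: momentum_point_def step_def)
qed

text \<open>By the error criterion, \<open>(1 - \<nu>) * norm g\<close> is at most the gradient norm
  at the extrapolated point, which is at most \<open>L * ((1 + 2 * \<Gamma>) * \<rho>)\<close>; a
  small \<open>\<tau>\<close> turns this into a displacement of at most \<open>\<rho>\<close> from a
  point within \<open>3 * \<rho>\<close>. This crude bound legitimates the estimates at
  \<open>x (k + 1)\<close>; the radius \<open>\<rho>\<close> is recovered in
  \<open>trapped\<close>.\<close>

lemma next_ball: "x (k + 1) \<in> ball xbar R"
proof -
  obtain g where g: "x (k + 1) = momentum_point \<beta> x k - \<tau> *\<^sub>R g"
      "norm (g - gradient f (momentum_point \<gamma> x k)) \<le> \<nu> * norm g"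
    by (rule gradient_obtain)
  have "norm g \<le> \<nu> * norm g + norm (gradient f (momentum_point \<gamma> x k))"
    using g(2) norm_triangle_sub[of g "gradient f (momentum_point \<gamma> x k)"] by linarith
  also have "\<dots> \<le> \<nu> * norm g + L * ((1 + 2 * \<Gamma>) * \<rho>)"
    using gradient_le[OF ex_ball] ex_dist L by (smt (verit) mult_left_mono)
  finally have "\<tau> * ((1 - \<nu>) * norm g) \<le> \<tau> * (L * ((1 + 2 * \<Gamma>) * \<rho>))"
    using \<tau> by (intro mult_left_mono) (auto simp: algebra_simps)
  also have "\<dots> \<le> 2 * (\<tau> * (L * (\<Gamma> + 1))) * \<rho>"
    using \<tau> L \<rho> by (simp add: algebra_simps)
  also have "\<dots> \<le> (1 - \<nu>) * \<rho>"
  proof (rule mult_right_mono)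
    have "0 \<le> B\<^sup>2" by simp
    then show "2 * (\<tau> * (L * (\<Gamma> + 1))) \<le> 1 - \<nu>" using \<tau>(3) \<nu> unfolding a_def by argo
  qed (use \<rho> in simp)
  finally have "(1 - \<nu>) * (\<tau> * norm g) \<le> (1 - \<nu>) * \<rho>" by (simp add: ac_simps)
  then have "norm (\<tau> *\<^sub>R g) \<le> \<rho>" using \<nu> \<tau> by simp
  moreover have "dist xbar (x (k + 1)) \<le> dist xbar (momentum_point \<beta> x k) + norm (\<tau> *\<^sub>R g)"
    using dist_triangle[of xbar "x (k + 1)" "momentum_point \<beta> x k"]
    unfolding dist_norm[of "momentum_point \<beta> x k" "x (k + 1)"] g(1) by simp
  ultimately show ?thesis
    using in_dist \<rho>_le by simp
qed

lemma gradient_ex_le: "norm (gradient f (x k) - gradient f (momentum_point \<gamma> x k)) \<le> L * \<Gamma> * norm (step k)"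
proof -
  have "norm (gradient f (x k) - gradient f (momentum_point \<gamma> x k))
      \<le> L * norm (x k - momentum_point \<gamma> x k)"
    by (rule lip[OF ball_R[OF x_ball] ex_ball])
  also have "\<dots> = L * (\<gamma> k * norm (step k))"
    using \<gamma>[OF k] by (simp add: momentum_point_def step_def)
  also have "\<dots> \<le> L * (\<Gamma> * norm (step k))"
    using \<gamma>[OF k] L by (intro mult_left_mono mult_right_mono) auto
  finally show ?thesis by simp
qed

text \<open>After multiplication by \<open>2 * \<tau>\<close>, the leading coefficients are
  \<open>B\<^sup>2\<close> for the old step and \<open>-(1 - \<nu>)\<close> for the new one, and the
  Lipschitz remainders are at most \<open>2 * a\<close> times the sum of squares. A weight
  \<open>c\<close> between \<open>B\<^sup>2\<close> and \<open>1 - \<nu>\<close> turns this into a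
  decrease in both steps.\<close>

lemma H_decrease: "a * (w k)\<^sup>2 \<le> 2 * \<tau> * (H k - H (k + 1))"
proof -
  let ?d = "norm (step k)" and ?e = "norm (step (k + 1))" and ?G = "gradient f (momentum_point \<gamma> x k)"
  obtain g where g: "\<tau> *\<^sub>R g = \<beta> k *\<^sub>R step k - step (k + 1)" "norm (g - ?G) \<le> \<nu> * norm g"
    by (rule gradient_obtain)
  have "f (x (k + 1)) \<le> f (x k) + gradient f (x k) \<bullet> step (k + 1) + L * ?e\<^sup>2"
    using Lipschitz_gradient_upper_bound[of "ball xbar r" f L "x k" "step (k + 1)"]
      diff lip L ball_R[OF x_ball] ball_R[OF next_ball] by (simp add: step_def)
  also have "gradient f (x k) \<bullet> step (k + 1)
      = ?G \<bullet> step (k + 1) + (gradient f (x k) - ?G) \<bullet> step (k + 1)"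
    by (simp add: inner_diff_left)
  also have "(gradient f (x k) - ?G) \<bullet> step (k + 1) \<le> L * \<Gamma> * ?d * ?e"
    by (rule order_trans[OF norm_cauchy_schwarz]) (intro mult_right_mono gradient_ex_le, simp)
  also have "?G \<bullet> step (k + 1) \<le> ((\<beta> k)\<^sup>2 * ?d\<^sup>2 - (1 - \<nu>) * ?e\<^sup>2) / (2 * \<tau>)"
    using g \<tau> \<nu> by (intro inexact_momentum_inner_bound) auto
  finally have "f (x (k + 1)) - f (x k) \<le> ((\<beta> k)\<^sup>2 * ?d\<^sup>2 - (1 - \<nu>) * ?e\<^sup>2) / (2 * \<tau>)
      + (L * \<Gamma> * ?d * ?e + L * ?e\<^sup>2)" by simp
  then have "2 * \<tau> * (f (x (k + 1)) - f (x k)) \<le> 2 * \<tau> * (((\<beta> k)\<^sup>2 * ?d\<^sup>2 - (1 - \<nu>) * ?e\<^sup>2) / (2 * \<tau>)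
      + (L * \<Gamma> * ?d * ?e + L * ?e\<^sup>2))"
    using \<tau> by (intro mult_left_mono) auto
  also have "\<dots> = (\<beta> k)\<^sup>2 * ?d\<^sup>2 - (1 - \<nu>) * ?e\<^sup>2 + 2 * (\<tau> * (L * \<Gamma> * ?d * ?e + L * ?e\<^sup>2))"
    using \<tau> by (simp add: field_simps)
  also have "\<dots> \<le> B\<^sup>2 * ?d\<^sup>2 - (1 - \<nu>) * ?e\<^sup>2 + 2 * (a * (?d\<^sup>2 + ?e\<^sup>2))"
  proof -
    have "L * \<Gamma> * ?d * ?e = L * \<Gamma> * (?d * ?e)" by simp
    also have "\<dots> \<le> L * \<Gamma> * (?d\<^sup>2 + ?e\<^sup>2)"
    proof (rule mult_left_mono)
      have "0 \<le> ?d * ?e" by simp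
      then show "?d * ?e \<le> ?d\<^sup>2 + ?e\<^sup>2" using sum_squares_bound[of ?d ?e] by linarith
    qed (use L \<Gamma> in simp)
    finally have "L * \<Gamma> * ?d * ?e + L * ?e\<^sup>2 \<le> L * \<Gamma> * (?d\<^sup>2 + ?e\<^sup>2) + L * (?d\<^sup>2 + ?e\<^sup>2)"
      using L by (intro add_mono mult_left_mono) auto
    then have "L * \<Gamma> * ?d * ?e + L * ?e\<^sup>2 \<le> L * (\<Gamma> + 1) * (?d\<^sup>2 + ?e\<^sup>2)"
      by (simp add: algebra_simps)
    then have "\<tau> * (L * \<Gamma> * ?d * ?e + L * ?e\<^sup>2) \<le> \<tau> * (L * (\<Gamma> + 1) * (?d\<^sup>2 + ?e\<^sup>2))"
      using \<tau> by (intro mult_left_mono) auto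
    also have "\<dots> = \<tau> * (L * (\<Gamma> + 1)) * (?d\<^sup>2 + ?e\<^sup>2)" by simp
    also have "\<dots> \<le> a * (?d\<^sup>2 + ?e\<^sup>2)" using \<tau> by (intro mult_right_mono) auto
    finally have "\<tau> * (L * \<Gamma> * ?d * ?e + L * ?e\<^sup>2) \<le> a * (?d\<^sup>2 + ?e\<^sup>2)" .
    moreover have "(\<beta> k)\<^sup>2 * ?d\<^sup>2 \<le> B\<^sup>2 * ?d\<^sup>2"
      using \<beta>[OF k] by (intro mult_right_mono power_mono) auto
    ultimately show ?thesis by linarith
  qed
  finally have 1: "2 * \<tau> * (f (x (k + 1)) - f (x k))
      \<le> B\<^sup>2 * ?d\<^sup>2 - (1 - \<nu>) * ?e\<^sup>2 + 2 * (a * (?d\<^sup>2 + ?e\<^sup>2))" .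
  have 2: "2 * \<tau> * (H k - H (k + 1)) = c * ?d\<^sup>2 - c * ?e\<^sup>2 - 2 * \<tau> * (f (x (k + 1)) - f (x k))"
    using \<tau> by (simp add: H_def field_simps)
  \<comment> \<open>As the midpoint, \<open>c\<close> leaves the margin \<open>4 * a\<close> on both
    sides: one half absorbs the remainders, the other half is the decrease.\<close>
  have 3: "c - B\<^sup>2 = 4 * a" "1 - \<nu> - c = 4 * a" by (auto simp: a_def c_def field_simps)
  have "2 * (a * (?d\<^sup>2 + ?e\<^sup>2)) = (c - B\<^sup>2) * ?d\<^sup>2 + (1 - \<nu> - c) * ?e\<^sup>2 - 2 * (a * (?d\<^sup>2 + ?e\<^sup>2))"
    unfolding 3 by (simp add: algebra_simps)
  also have "\<dots> \<le> 2 * \<tau> * (H k - H (k + 1))" using 1 unfolding 2 by (simp add: algebra_simps)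
  also have "2 * (a * (?d\<^sup>2 + ?e\<^sup>2)) = a * (2 * (?d\<^sup>2 + ?e\<^sup>2))" by simp
  finally have "a * (2 * (?d\<^sup>2 + ?e\<^sup>2)) \<le> 2 * \<tau> * (H k - H (k + 1))" .
  moreover have "a * (w k)\<^sup>2 \<le> a * (2 * (?d\<^sup>2 + ?e\<^sup>2))"
    using a_pos sum_squares_bound[of ?d ?e]
    by (intro mult_left_mono) (auto simp: w_def power2_sum)
  ultimately show ?thesis by linarith
qed

text \<open>Inexactness gives the factor \<open>1 + \<nu> \<le> 2\<close>, and returning from the
  extrapolated point to \<open>x k\<close> costs \<open>L * \<Gamma>\<close> because
  \<open>\<tau> \<le> 1\<close>; together they form \<open>K\<close>.\<close>

lemma gradient_le_w: "\<tau> * norm (gradient f (x k)) \<le> K * w k"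
proof -
  let ?G = "gradient f (momentum_point \<gamma> x k)"
  obtain g where g: "\<tau> *\<^sub>R g = \<beta> k *\<^sub>R step k - step (k + 1)" "norm (g - ?G) \<le> \<nu> * norm g"
    by (rule gradient_obtain)
  have "norm ?G \<le> norm g + \<nu> * norm g"
    using g(2) norm_triangle_sub[of ?G g] by (simp add: norm_minus_commute)
  also have "\<dots> \<le> 2 * norm g" using \<nu> mult_right_mono[of \<nu> 1 "norm g"] by simp
  finally have "\<tau> * norm ?G \<le> 2 * (\<tau> * norm g)" using \<tau> by simp
  also have "\<tau> * norm g = norm (\<beta> k *\<^sub>R step k - step (k + 1))"
    using arg_cong[OF g(1), of norm] \<tau> by simp
  also have "\<dots> \<le> \<beta> k * norm (step k) + norm (step (k + 1))"
    using norm_triangle_ineq4[of "\<beta> k *\<^sub>R step k" "step (k + 1)"] \<beta>[OF k] by simp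
  also have "\<dots> \<le> w k"
    using mult_right_mono[of "\<beta> k" 1 "norm (step k)"] \<beta>[OF k] B_less by (simp add: w_def)
  finally have "\<tau> * norm ?G \<le> 2 * w k" by simp
  moreover have "\<tau> * norm (gradient f (x k) - ?G) \<le> 1 * (L * \<Gamma> * w k)"
  proof (rule mult_mono)
    have "L * \<Gamma> * norm (step k) \<le> L * \<Gamma> * w k"
      using L \<Gamma> by (intro mult_left_mono) (auto simp: w_def)
    then show "norm (gradient f (x k) - ?G) \<le> L * \<Gamma> * w k" using gradient_ex_le by linarith
  qed (use \<tau> in auto)
  moreover have "\<tau> * norm (gradient f (x k)) \<le> \<tau> * (norm ?G + norm (gradient f (x k) - ?G))"
    using \<tau> norm_triangle_sub[of "gradient f (x k)" ?G] by (intro mult_left_mono) auto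
  ultimately show ?thesis by (simp add: K_def algebra_simps)
qed

text \<open>The cases ask which part of \<open>H k\<close> dominates. If the function gap is at
  least the kinetic term, it is at least \<open>H k / 2\<close>, and PLK combines with
  \<open>gradient_le_w\<close>; otherwise \<open>H k\<close> is at most twice the kinetic term, and
  \<open>c < 1\<close> suffices.\<close>

lemma H_alternative:
  assumes "H k \<le> t"
  shows "(\<exists>s. H k \<le> 2 * s \<and> s \<le> H k \<and> \<tau> \<le> deriv \<phi> s * (K * w k)) \<or> \<tau> * H k \<le> (w k)\<^sup>2"
proof -
  let ?s = "f (x k) - f xbar" and ?q = "c / (2 * \<tau>) * (norm (step k))\<^sup>2"
  show ?thesis
  proof (cases "?q \<le> ?s")
    case True
    then have "H k \<le> 2 * ?s" by (simp add: H_def)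
    then have "0 < ?s" using H_pos[OF k x_ball] by argo
    then have P: "1 \<le> deriv \<phi> ?s * norm (gradient f (x k))"
      using f_le_H[of k] assms by (intro PLK x_ball) auto
    then have "0 \<le> deriv \<phi> ?s"
      by (smt (verit) mult_nonpos_nonneg norm_ge_zero)
    then have "deriv \<phi> ?s * (\<tau> * norm (gradient f (x k))) \<le> deriv \<phi> ?s * (K * w k)"
      by (intro mult_left_mono gradient_le_w)
    moreover have "\<tau> * 1 \<le> \<tau> * (deriv \<phi> ?s * norm (gradient f (x k)))"
      using P \<tau> by (intro mult_left_mono) auto
    ultimately show ?thesis using f_le_H[of k] \<open>H k \<le> 2 * ?s\<close> by (intro disjI1 exI[of _ ?s]) (auto simp: mult.left_commute)
  next
    case False
    then have "H k \<le> 2 * ?q" unfolding H_def by linarith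
    then have "\<tau> * H k \<le> \<tau> * (2 * ?q)" using \<tau> by (intro mult_left_mono) auto
    also have "\<dots> = c * (norm (step k))\<^sup>2" using \<tau> by simp
    also have "\<dots> \<le> 1 * (w k)\<^sup>2"
      using c_less by (intro mult_mono power_mono) (auto simp: w_def)
    finally show ?thesis by simp
  qed
qed

lemma step_le_potential:
  assumes "H k \<le> t"
  shows "a * w k \<le> 4 * K * (potential \<phi> (H k) - potential \<phi> (H (k + 1)))"
  using assms \<tau> a_pos K w_nonneg H_decrease H_alternative H_pos[of "k + 1"] next_ball
  by (intro potential_decrease[where t = t and \<phi>' = "deriv \<phi>" and \<tau> = \<tau>] slope mono) auto

end


section \<open>Confinement of the trajectory to the ball of radius \<open>\<rho>\<close>\<close>

lemma potential_diff_le: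
  assumes "0 < v" "v \<le> u" "u \<le> t"
  shows "4 * K * (potential \<phi> u - potential \<phi> v) \<le> a * \<rho> / 2"
proof -
  have "\<phi> (u / 2) - \<phi> (v / 2) \<le> \<epsilon>" using assms by (intro osc) auto
  moreover have "sqrt u \<le> sqrt t" "0 \<le> sqrt v" using assms by auto
  \<comment> \<open>One \<open>\<epsilon>\<close> pays for the oscillation of \<open>\<phi>\<close>
    and one for the square root; by \<open>16 * K * \<epsilon> \<le> a * \<rho>\<close> this allows
    a path of length at most \<open>\<rho> / 2\<close>.\<close>
  ultimately have "potential \<phi> u - potential \<phi> v \<le> 2 * \<epsilon>"
    using \<epsilon> unfolding potential_def by linarith
  then have "4 * K * (potential \<phi> u - potential \<phi> v) \<le> 4 * K * (2 * \<epsilon>)"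
    using K by (intro mult_left_mono) auto
  also have "\<dots> \<le> a * \<rho> / 2" using \<epsilon> by simp
  finally show ?thesis .
qed

text \<open>The induction is joint: the one-step estimates require the last two points within
  \<open>\<rho>\<close>, and summing them bounds the displacement from \<open>x 0\<close> by
  \<open>\<rho> / 2\<close>, which together with \<open>x0\<close> keeps the next point within
  \<open>\<rho>\<close>. Monotonicity of \<open>H\<close> keeps the Lyapunov values below
  \<open>t\<close>.\<close>

lemma trapped:
  assumes "k \<ge> 1"
  shows "(\<forall>j\<le>k. dist xbar (x j) < \<rho>) \<and> 0 < H k \<and> H k \<le> H 1 \<and>
    a * dist (x k) (x 0) \<le> 4 * K * (potential \<phi> (H 1) - potential \<phi> (H k))"
  using assms
proof (induction k rule: dec_induct)
  case base
  have [simp]: "x (Suc 0) = x 0" using IGDm by (simp add: IGDm_def)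
  have "dist xbar (x j) < \<rho>" if "j \<le> 1" for j
    using that x0(1) \<rho> by (cases "j = 0") (auto simp: le_Suc_eq)
  moreover have "0 < H 1"
    using x0 \<rho> \<rho>_le by (intro H_pos) auto
  ultimately show ?case by simp
next
  case (step k)
  have x1: "x (Suc 0) = x 0" using IGDm by (simp add: IGDm_def)
  have H1: "H 1 \<le> t" using x0 by (simp add: H_def step_def x1)
  have near: "dist xbar (x (k - 1)) < \<rho>" "dist xbar (x k) < \<rho>" using step.IH by auto
  note facts = \<open>1 \<le> k\<close> near
  have H: "0 < H (k + 1)" using facts by (intro H_pos next_ball) auto
  have "0 \<le> a * (w k)\<^sup>2" using a_pos by simp
  then have dec: "H (k + 1) \<le> H k"
    using H_decrease[OF facts] \<tau> by (smt (verit) mult_pos_neg)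
  have "a * w k \<le> 4 * K * (potential \<phi> (H k) - potential \<phi> (H (k + 1)))"
    using step.IH H1 by (intro step_le_potential facts) auto
  moreover have "dist (x (k + 1)) (x k) \<le> w k" by (simp add: w_def step_def dist_norm)
  then have "a * dist (x (k + 1)) (x 0) \<le> a * w k + a * dist (x k) (x 0)"
    using a_pos dist_triangle[of "x (k + 1)" "x 0" "x k"]
    by (simp flip: distrib_left)
  ultimately have d: "a * dist (x (k + 1)) (x 0)
      \<le> 4 * K * (potential \<phi> (H 1) - potential \<phi> (H (k + 1)))"
    using step.IH by (simp add: right_diff_distrib)
  also have "\<dots> \<le> a * (\<rho> / 2)"
    using H dec H1 step.IH potential_diff_le[of "H (k + 1)" "H 1"] by simp
  finally have "dist (x (k + 1)) (x 0) \<le> \<rho> / 2" using a_pos by (simp only: mult_le_cancel_left_pos)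
  then have "dist xbar (x (k + 1)) < \<rho>"
    using x0 dist_triangle[of xbar "x (k + 1)" "x 0"] by (simp add: dist_commute)
  then show ?case using step.IH H dec d by (auto simp: le_Suc_eq)
qed

lemma near: "dist xbar (x k) < \<rho>"
  \<comment> \<open>The index \<open>Suc k\<close> makes \<open>trapped\<close> cover
    \<open>k = 0\<close> as well.\<close>
  using trapped[of "Suc k"] by auto

lemma H_gt_0: "k \<ge> 1 \<Longrightarrow> 0 < H k"
  using trapped by blast

lemma x1: "x 1 = x 0"
  using IGDm by (simp add: IGDm_def)

lemma H_le_t: "k \<ge> 1 \<Longrightarrow> H k \<le> t"
proof -
  assume "k \<ge> 1"
  then have "H k \<le> H 1" using trapped by blast
  also have "H 1 \<le> t" using x0 x1 by (simp add: H_def step_def)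
  finally show ?thesis .
qed

section \<open>Convergence and properties of the limit\<close>

lemma converges:
  obtains z where "x \<longlonglongrightarrow> z"
    "\<And>l k. k \<ge> 1 \<Longrightarrow> (\<And>k. k \<ge> 1 \<Longrightarrow> l \<le> potential \<phi> (H k)) \<Longrightarrow>
      a * dist (x k) z \<le> 4 * K * (potential \<phi> (H k) - l)"
proof -
  let ?C = "4 * K / a"
  \<comment> \<open>The index is shifted because the estimates start at \<open>k = 1\<close>; the
    factor \<open>?C\<close> contains the division by \<open>a\<close> that leaves a bound on the
    distance itself.\<close>
  let ?y = "\<lambda>k. ?C * potential \<phi> (H (Suc k))"
  have C: "0 < ?C" using K a_pos by simp
  have step: "dist (x (Suc (Suc k))) (x (Suc k)) \<le> ?y k - ?y (Suc k)" for k
  proof -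
    have "a * w (Suc k) \<le> 4 * K * (potential \<phi> (H (Suc k)) - potential \<phi> (H (Suc k + 1)))"
      by (intro step_le_potential near H_le_t) auto
    then have "w (Suc k) \<le> ?y k - ?y (Suc k)"
      using a_pos by (simp add: field_simps)
    moreover have "dist (x (Suc (Suc k))) (x (Suc k)) \<le> w (Suc k)"
      by (simp add: w_def step_def dist_norm)
    ultimately show ?thesis by linarith
  qed
  \<comment> \<open>The limited total drop of the potential supplies the lower bound that
    convergence requires.\<close>
  have lower: "potential \<phi> (H 1) - a * \<rho> / (8 * K) \<le> potential \<phi> (H k)" if "k \<ge> 1" for k
  proof -
    have "4 * K * (potential \<phi> (H 1) - potential \<phi> (H k)) \<le> a * \<rho> / 2"
      using trapped[OF that] H_le_t[of 1] by (intro potential_diff_le) auto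
    then show ?thesis using K by (simp add: field_simps)
  qed
  obtain z where z: "(\<lambda>k. x (Suc k)) \<longlonglongrightarrow> z"
    "\<And>l k. (\<And>k. l \<le> ?y k) \<Longrightarrow> dist (x (Suc k)) z \<le> ?y k - l"
    using converges_if_steps_telescope[of "\<lambda>k. x (Suc k)" ?y
        "?C * (potential \<phi> (H 1) - a * \<rho> / (8 * K))", OF step mult_left_mono[OF lower]] C
    by (metis Suc_eq_plus1 le_add2 less_imp_le)
  show ?thesis
  proof
    show "x \<longlonglongrightarrow> z" using z(1) by (simp add: filterlim_sequentially_Suc)
    fix l k assume k: "k \<ge> (1::nat)" and l: "\<And>k. k \<ge> 1 \<Longrightarrow> l \<le> potential \<phi> (H k)"
    have "dist (x (Suc (k - 1))) z \<le> ?y (k - 1) - ?C * l"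
      using C by (intro z(2) mult_left_mono l) auto
    then show "a * dist (x k) z \<le> 4 * K * (potential \<phi> (H k) - l)"
      using k a_pos by (simp add: field_simps)
  qed
qed

context
  fixes z assumes z: "x \<longlonglongrightarrow> z"
begin

lemma z_ball: "z \<in> ball xbar R"
proof -
  have "dist xbar z \<le> \<rho>"
    using near by (intro LIMSEQ_le_const2[OF tendsto_dist[OF tendsto_const z]]) (auto intro: less_imp_le)
  then show ?thesis using \<rho>_le \<rho> by simp
qed

lemma step_tendsto: "step \<longlonglongrightarrow> 0"
proof -
  have "(\<lambda>k. step (Suc k)) \<longlonglongrightarrow> z - z"
    unfolding step_def using LIMSEQ_Suc[OF z] z by (intro tendsto_diff) auto
  then show ?thesis by (simp add: filterlim_sequentially_Suc)
qed

lemma momentum_point_tendsto: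
  assumes "\<And>k. k \<ge> 1 \<Longrightarrow> \<bar>\<alpha> k\<bar> \<le> C"
  shows "momentum_point \<alpha> x \<longlonglongrightarrow> z"
proof -
  have "(\<lambda>k. \<alpha> k *\<^sub>R step k) \<longlonglongrightarrow> 0"
  proof (rule Lim_null_comparison)
    show "(\<lambda>k. C * norm (step k)) \<longlonglongrightarrow> 0"
      using tendsto_mult_right_zero[OF tendsto_norm_zero[OF step_tendsto]] .
    show "\<forall>\<^sub>F k in sequentially. norm (\<alpha> k *\<^sub>R step k) \<le> C * norm (step k)"
      using assms by (intro eventually_sequentiallyI[of 1]) (auto intro: mult_right_mono)
  qed
  from tendsto_add[OF z this] show ?thesis
    by (simp add: momentum_point_def[abs_def] step_def)
qed

lemma gradient_norm_le: "norm (gradient f (x k) - gradient f z) \<le> L * dist (x k) z"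
  using lip[of "x k" z] ball_R z_ball near[of k] \<rho> \<rho>_le R by (simp add: dist_norm)

text \<open>\<open>\<tau> * norm (gradient f (x k))\<close> is at most \<open>K * w k\<close>, which
  tends to 0, and the Lipschitz bound passes this to the limit.\<close>

lemma gradient_z: "gradient f z = 0"
proof -
  have w: "w \<longlonglongrightarrow> 0"
    unfolding w_def using tendsto_norm_zero[OF step_tendsto]
    by (auto intro!: tendsto_add_zero LIMSEQ_Suc[of "\<lambda>k. norm (step k)"])
  have "(\<lambda>k. gradient f (x k)) \<longlonglongrightarrow> 0"
  proof (rule Lim_null_comparison)
    show "(\<lambda>k. K / \<tau> * w k) \<longlonglongrightarrow> 0" by (rule tendsto_mult_right_zero[OF w])
    show "\<forall>\<^sub>F k in sequentially. norm (gradient f (x k)) \<le> K / \<tau> * w k"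
      using gradient_le_w near \<tau> by (intro eventually_sequentiallyI[of 1]) (auto simp: field_simps)
  qed
  moreover have "(\<lambda>k. gradient f (x k)) \<longlonglongrightarrow> gradient f z"
  proof (rule Lim_null_comparison[THEN Lim_null[THEN iffD2]])
    show "(\<lambda>k. L * dist (x k) z) \<longlonglongrightarrow> 0"
      using tendsto_dist[OF z tendsto_const[of z]] by (intro tendsto_mult_right_zero) simp
  qed (use gradient_norm_le in auto)
  ultimately show ?thesis by (rule LIMSEQ_unique[symmetric])
qed

text \<open>A limit with a larger value would still have a function gap of at most \<open>t\<close>,
  so PLK at \<open>z\<close> would force a nonzero gradient.\<close>

lemma f_z: "f z = f xbar"
proof (rule ccontr)
  assume "f z \<noteq> f xbar"
  then have "f xbar < f z" using min[OF z_ball] by simp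
  moreover have "isCont f z"
    using diff[OF ball_R[OF z_ball]] by (rule differentiable_imp_continuous_within)
  then have "(\<lambda>k. f (x k) - f xbar) \<longlonglongrightarrow> f z - f xbar"
    using z by (intro tendsto_intros isCont_tendsto_compose[of z f])
  then have "f z - f xbar \<le> t"
    using order_trans[OF f_le_H H_le_t] by (intro LIMSEQ_le_const2) (blast intro: exI[of _ 1])+
  ultimately show False using PLK[OF z_ball] gradient_z by simp
qed

lemma local_minimizer_z: "local_minimizer f (ball xbar r) z"
proof -
  obtain e where "0 < e" "ball z e \<subseteq> ball xbar R"
    using z_ball openE[OF open_ball] by blast
  then show ?thesis
    unfolding local_minimizer_def using z_ball ball_R min f_z by (auto intro!: exI[of _ e])
qed

lemma momentum_limits: "momentum_point \<beta> x \<longlonglongrightarrow> z" "momentum_point \<gamma> x \<longlonglongrightarrow> z"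
  using momentum_point_tendsto[of \<beta> B] momentum_point_tendsto[of \<gamma> \<Gamma>] \<beta> \<gamma> by auto

section \<open>Convergence rates under the exponential condition\<close>

context
  fixes M q assumes \<phi>_eq: "\<phi> = (\<lambda>t. M * t powr (1 - q))" and M: "0 < M" and q: "1 / 2 \<le> q" "q < 1"
begin

lemma t_pos: "0 < t"
  using H_gt_0[of 1] H_le_t[of 1] by simp

text \<open>This factor relates \<open>sqrt (H k)\<close> to \<open>H k powr q\<close> and to
  \<open>H k powr (1 - q)\<close>; it is bounded because \<open>q \<ge> 1 / 2\<close>.\<close>

lemma H_powr_le:
  assumes "k \<ge> 1"
  shows "H k powr (q - 1 / 2) \<le> t powr (q - 1 / 2)"
  using H_gt_0[OF assms] H_le_t[OF assms] q by (intro powr_mono2) auto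

text \<open>\<open>H_alternative\<close> yields \<open>H k powr q \<le> C * w k\<close>; squaring
  and inserting \<open>H_decrease\<close> gives the recursion. The constant depends on
  \<open>\<tau>\<close>, which is fixed within a run.\<close>

lemma H_recursion:
  obtains C where "0 < C" "\<And>k. k \<ge> 1 \<Longrightarrow> H (k + 1) \<le> H k - C * H k powr (2 * q)"
proof -
  \<comment> \<open>The first entry serves the PLK case of \<open>H_alternative\<close>, the second
    the kinetic case.\<close>
  define C where "C = max (2 * M * (1 - q) * K / \<tau>) (t powr (q - 1 / 2) / sqrt \<tau>)"
  have "0 < t powr (q - 1 / 2) / sqrt \<tau>" using t_pos \<tau> by simp
  then have C: "0 < C" by (simp add: C_def less_max_iff_disj)
  have le: "H k powr q \<le> C * w k" if k: "k \<ge> 1" for k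
  proof -
    have H: "0 < H k" using H_gt_0[OF k] .
    have sqrtH: "sqrt (H k) = H k powr (1 / 2)" using H by (simp add: powr_half_sqrt)
    consider s where "H k \<le> 2 * s" "\<tau> \<le> deriv \<phi> s * (K * w k)" | "\<tau> * H k \<le> (w k)\<^sup>2"
      using H_alternative[OF k near near H_le_t[OF k]] by blast
    then show ?thesis
    proof cases
      case (1 s)
      then have s: "0 < s" using H by simp
      have "((\<lambda>t. M * t powr (1 - q)) has_real_derivative M * (1 - q) * s powr - q) (at s)"
        using s by (auto intro!: derivative_eq_intros)
      then have "deriv \<phi> s = M * (1 - q) * s powr - q"
        unfolding \<phi>_eq by (rule DERIV_imp_deriv)
      \<comment> \<open>The negative power decreases, so \<open>H k / 2 \<le> s\<close> bounds the
        derivative; \<open>2 powr q \<le> 2\<close> then simplifies the factor that halving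
        leaves.\<close>
      also have "s powr - q \<le> (H k / 2) powr - q"
        using 1 H q by (intro powr_mono2') auto
      also have "\<dots> = 2 powr q * H k powr - q"
        using H by (simp add: powr_divide powr_minus field_simps)
      also have "\<dots> \<le> 2 * H k powr - q"
        using q powr_mono[of q 1 "2::real"] by (intro mult_right_mono) auto
      finally have "deriv \<phi> s \<le> 2 * M * (1 - q) * H k powr - q"
        using M q by (simp add: mult_left_mono)
      then have "\<tau> \<le> 2 * M * (1 - q) * H k powr - q * (K * w k)"
        using 1 K w_nonneg by (smt (verit) mult_nonneg_nonneg mult_right_mono)
      then have "\<tau> * H k powr q \<le> 2 * M * (1 - q) * H k powr - q * (K * w k) * H k powr q"
        by (rule mult_right_mono) simp
      also have "\<dots> = 2 * M * (1 - q) * K * w k"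
        using H by (simp add: powr_minus)
      finally have "H k powr q \<le> 2 * M * (1 - q) * K / \<tau> * w k"
        using \<tau> by (simp add: field_simps)
      also have "\<dots> \<le> C * w k" using w_nonneg by (intro mult_right_mono) (auto simp: C_def)
      finally show ?thesis .
    next
      case 2
      then have "sqrt \<tau> * sqrt (H k) \<le> w k"
        using w_nonneg by (simp add: real_le_lsqrt flip: real_sqrt_mult)
      then have "sqrt (H k) \<le> w k / sqrt \<tau>" using \<tau> by (simp add: field_simps)
      have "H k powr q = H k powr (q - 1 / 2) * sqrt (H k)"
        unfolding sqrtH by (simp flip: powr_add)
      also have "\<dots> \<le> t powr (q - 1 / 2) * (w k / sqrt \<tau>)"
        using H_powr_le[OF k] \<open>sqrt (H k) \<le> w k / sqrt \<tau>\<close> H by (intro mult_mono) auto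
      also have "\<dots> = t powr (q - 1 / 2) / sqrt \<tau> * w k" by simp
      also have "\<dots> \<le> C * w k" using w_nonneg by (intro mult_right_mono) (auto simp: C_def)
      finally show ?thesis .
    qed
  qed
  show ?thesis
  proof
    show "0 < a / (2 * \<tau> * C\<^sup>2)" using a_pos \<tau> C by simp
    fix k :: nat assume k: "k \<ge> 1"
    have "a * H k powr (2 * q) = a * (H k powr q)\<^sup>2"
      by (simp add: power2_eq_square flip: powr_add)
    also have "\<dots> \<le> a * (C * w k)\<^sup>2"
      using le[OF k] a_pos by (intro mult_left_mono power_mono) auto
    also have "\<dots> = C\<^sup>2 * (a * (w k)\<^sup>2)" by (simp add: power_mult_distrib)
    also have "\<dots> \<le> C\<^sup>2 * (2 * \<tau> * (H k - H (k + 1)))"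
      by (intro mult_left_mono H_decrease k near) auto
    finally show "H (k + 1) \<le> H k - a / (2 * \<tau> * C\<^sup>2) * H k powr (2 * q)"
      using C \<tau> by (simp add: field_simps)
  qed
qed

text \<open>The potential is nonnegative for this \<open>\<phi>\<close>, so the tail estimate holds
  with \<open>l = 0\<close>. Both of its terms are bounded by multiples of
  \<open>H k powr (1 - q)\<close>, the square root by means of \<open>H_powr_le\<close>.\<close>

lemma dist_le_H_powr:
  obtains C where "0 < C" "\<And>k. k \<ge> 1 \<Longrightarrow> dist (x k) z \<le> C * H k powr (1 - q)"
proof
  show "0 < 4 * K / a * (M + t powr (q - 1 / 2))"
    using K a_pos M by (simp add: add_pos_nonneg)
  fix k :: nat assume k: "k \<ge> 1"
  have H: "0 < H k" using H_gt_0[OF k] .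
  have "0 \<le> potential \<phi> (H k)" if "k \<ge> 1" for k
    using M H_gt_0[OF that] by (simp add: potential_def \<phi>_eq)
  \<comment> \<open>\<open>LIMSEQ_unique\<close> identifies the limit obtained from
    \<open>converges\<close> with the fixed \<open>z\<close>.\<close>
  then have "a * dist (x k) z \<le> 4 * K * (potential \<phi> (H k) - 0)"
    using converges LIMSEQ_unique[OF z] k by metis
  also have "\<dots> \<le> 4 * K * ((M + t powr (q - 1 / 2)) * H k powr (1 - q))"
  proof (rule mult_left_mono)
    have "(H k / 2) powr (1 - q) \<le> H k powr (1 - q)"
      using H q by (intro powr_mono2) auto
    then have "M * (H k / 2) powr (1 - q) \<le> M * H k powr (1 - q)" using M by simp
    moreover have "sqrt (H k) = H k powr (q - 1 / 2) * H k powr (1 - q)"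
      using H by (simp flip: powr_add add: powr_half_sqrt)
    then have "sqrt (H k) \<le> t powr (q - 1 / 2) * H k powr (1 - q)"
      using H_powr_le[OF k] by (simp add: mult_right_mono)
    ultimately show "potential \<phi> (H k) - 0 \<le> (M + t powr (q - 1 / 2)) * H k powr (1 - q)"
      by (simp add: potential_def \<phi>_eq distrib_right)
  qed (use K in simp)
  finally show "dist (x k) z \<le> 4 * K / a * (M + t powr (q - 1 / 2)) * H k powr (1 - q)"
    using a_pos by (simp add: field_simps)
qed

lemma norm_gradient_le: "norm (gradient f (x k)) \<le> L * dist (x k) z"
  using gradient_norm_le by (simp add: gradient_z)

lemma f_error: "\<bar>f (x k) - f z\<bar> \<le> H k"
proof -
  have "x k \<in> ball xbar R" using near[of k] \<rho>_le \<rho> by simp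
  from min[OF this] show ?thesis using f_le_H[of k] by (simp add: f_z)
qed

text \<open>With \<open>2 * q = 1\<close> the recursion is geometric; distances are bounded by a
  multiple of \<open>sqrt (H k)\<close> and therefore decay with ratio
  \<open>sqrt \<sigma>\<close>.\<close>

lemma linear_rate:
  assumes "q = 1 / 2"
  shows "converges_linearly x z" "converges_linearly (\<lambda>k. gradient f (x k)) 0"
    "converges_linearly (\<lambda>k. f (x k)) (f z)"
proof -
  obtain C0 where C0: "0 < C0" "\<And>k. k \<ge> 1 \<Longrightarrow> H (k + 1) \<le> H k - C0 * H k powr (2 * q)"
    using H_recursion by blast
  have rec: "H (k + 1) \<le> H k - C0 * H k" if "k \<ge> 1" for k
    using C0(2)[OF that] H_gt_0[OF that] assms by simp
  obtain C \<sigma> where C: "0 < C" "0 < \<sigma>" "\<sigma> < 1" "\<And>k. k \<ge> 1 \<Longrightarrow> H k \<le> C * \<sigma> ^ k"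
    using geometric_recursion_rate[where E = H, OF H_gt_0 C0(1) rec] by blast
  obtain D where D: "0 < D" "\<And>k. k \<ge> 1 \<Longrightarrow> dist (x k) z \<le> D * H k powr (1 - q)"
    using dist_le_H_powr by blast
  have dist: "dist (x k) z \<le> D * sqrt C * sqrt \<sigma> ^ k" if k: "k \<ge> 1" for k
  proof -
    have "D * H k powr (1 - q) = D * sqrt (H k)"
      using H_gt_0[OF k] by (simp add: assms powr_half_sqrt)
    also have "\<dots> \<le> D * sqrt (C * \<sigma> ^ k)"
      using C(4)[OF k] D by (intro mult_left_mono) auto
    finally show ?thesis using D(2)[OF k] by (simp add: real_sqrt_mult real_sqrt_power)
  qed
  have \<sigma>: "0 < sqrt \<sigma>" "sqrt \<sigma> < 1" using C by auto
  show "converges_linearly x z"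
    using C D \<sigma> dist by (intro converges_linearlyI[of "D * sqrt C" "sqrt \<sigma>"]) auto
  have "dist (gradient f (x k)) 0 \<le> L * (D * sqrt C) * sqrt \<sigma> ^ k" if "k \<ge> 1" for k
    using order_trans[OF norm_gradient_le[of k] mult_left_mono[OF dist[OF that]]] L
    by (simp add: mult.assoc)
  then show "converges_linearly (\<lambda>k. gradient f (x k)) 0"
    using C D \<sigma> L by (intro converges_linearlyI[of "L * (D * sqrt C)" "sqrt \<sigma>"]) auto
  show "converges_linearly (\<lambda>k. f (x k)) (f z)"
    using C order_trans[OF f_error C(4)]
    by (intro converges_linearlyI[of C \<sigma>]) (auto simp: dist_real_def)
qed

text \<open>The recursion has exponent \<open>1 + \<alpha>\<close> with
  \<open>\<alpha> = 2 * q - 1\<close>, so \<open>H k\<close> is at most of order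
  \<open>real k powr - (1 / \<alpha>)\<close>; the distance bound raises this to the power
  \<open>1 - q\<close>.\<close>

lemma sublinear_rate:
  assumes "1 / 2 < q"
  shows "(\<lambda>k. norm (x k - z)) \<in> O(\<lambda>k. real k powr (- ((1 - q) / (2 * q - 1))))"
    "(\<lambda>k. norm (gradient f (x k))) \<in> O(\<lambda>k. real k powr (- ((1 - q) / (2 * q - 1))))"
    "(\<lambda>k. f (x k) - f z) \<in> O(\<lambda>k. real k powr (- ((2 - 2 * q) / (2 * q - 1))))"
proof -
  define \<alpha> where "\<alpha> = 2 * q - 1"
  have \<alpha>: "0 < \<alpha>" using assms by (simp add: \<alpha>_def)
  obtain C0 where C0: "0 < C0" "\<And>k. k \<ge> 1 \<Longrightarrow> H (k + 1) \<le> H k - C0 * H k powr (2 * q)"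
    using H_recursion by blast
  have rec: "H (k + 1) \<le> H k - C0 * H k powr (1 + \<alpha>)" if "k \<ge> 1" for k
    using C0(2)[OF that] by (simp add: \<alpha>_def)
  obtain C where C: "0 < C" "\<And>k. k \<ge> 1 \<Longrightarrow> H k \<le> C * real k powr - (1 / \<alpha>)"
    using power_recursion_rate[where E = H, OF H_gt_0 \<alpha> C0(1) rec] by blast
  obtain D where D: "0 < D" "\<And>k. k \<ge> 1 \<Longrightarrow> dist (x k) z \<le> D * H k powr (1 - q)"
    using dist_le_H_powr by blast
  have dist: "dist (x k) z \<le> D * C powr (1 - q) * real k powr (- ((1 - q) / (2 * q - 1)))"
    if k: "k \<ge> 1" for k
  proof -
    have "D * H k powr (1 - q) \<le> D * (C * real k powr - (1 / \<alpha>)) powr (1 - q)"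
      using C(2)[OF k] D H_gt_0[OF k] q by (intro mult_left_mono powr_mono2) auto
    then show ?thesis
      using D(2)[OF k] C k by (simp add: powr_mult powr_powr \<alpha>_def)
  qed
  show "(\<lambda>k. norm (x k - z)) \<in> O(\<lambda>k. real k powr (- ((1 - q) / (2 * q - 1))))"
    using dist by (intro bigoI eventually_sequentiallyI[of 1]) (simp add: dist_norm)
  have "norm (gradient f (x k)) \<le> L * (D * C powr (1 - q)) * real k powr (- ((1 - q) / (2 * q - 1)))"
    if "k \<ge> 1" for k
    using order_trans[OF norm_gradient_le[of k] mult_left_mono[OF dist[OF that]]] L
    by (simp add: mult.assoc)
  then show "(\<lambda>k. norm (gradient f (x k))) \<in> O(\<lambda>k. real k powr (- ((1 - q) / (2 * q - 1))))"
    by (intro bigoI eventually_sequentiallyI[of 1]) simp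
  have "\<bar>f (x k) - f z\<bar> \<le> C * real k powr (- ((2 - 2 * q) / (2 * q - 1)))" if k: "k \<ge> 1" for k
  proof -
    \<comment> \<open>The bound on \<open>H k\<close> decays at least as fast as the claimed rate,
      because \<open>2 - 2 * q < 1\<close> and \<open>k \<ge> 1\<close>.\<close>
    have "C * real k powr - (1 / \<alpha>) \<le> C * real k powr (- ((2 - 2 * q) / (2 * q - 1)))"
      using C k \<alpha> q by (intro mult_left_mono powr_mono) (auto simp: \<alpha>_def divide_right_mono)
    then show ?thesis using f_error[of k] C(2)[OF k] by linarith
  qed
  then show "(\<lambda>k. f (x k) - f z) \<in> O(\<lambda>k. real k powr (- ((2 - 2 * q) / (2 * q - 1))))"
    by (intro bigoI eventually_sequentiallyI[of 1]) simp
qed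

end

end

end

section \<open>Choice of the neighbourhood and the step size\<close>

text \<open>The constants are fixed one after the other: \<open>R\<close> from minimality and PLK,
  then \<open>\<rho>\<close>, \<open>\<epsilon>\<close>, \<open>t\<close> and \<open>\<xi>\<close>.
  They are chosen before \<open>\<tau>\<close> and \<open>x\<close>, so one \<open>\<xi>\<close> and
  one \<open>T\<close> serve all runs.\<close>

lemma igdm_run_exists:
  fixes f :: "'a::euclidean_space \<Rightarrow> real"
  assumes r: "0 < r" and L: "0 < L" and C1: "C1_on f (ball xbar r)"
    and lip: "\<forall>y\<in>ball xbar r. \<forall>z\<in>ball xbar r. norm (gradient f y - gradient f z) \<le> L * norm (y - z)"
    and min: "local_minimizer f (ball xbar r) xbar"
    and PLK: "PLK_with f (ball xbar r) xbar \<phi>"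
    and \<nu>: "0 < \<nu>" "\<nu> < 1" and B: "0 \<le> B" "B\<^sup>2 < 1 - \<nu>"
    and \<beta>: "\<And>k. k \<ge> 1 \<Longrightarrow> 0 \<le> \<beta> k" "\<And>k. k \<ge> 1 \<Longrightarrow> \<beta> k \<le> B"
    and \<gamma>: "\<And>k. k \<ge> 1 \<Longrightarrow> 0 \<le> \<gamma> k" "\<And>k. k \<ge> 1 \<Longrightarrow> \<gamma> k \<le> \<Gamma>"
  obtains \<xi> T a c K R \<rho> t \<epsilon> where "0 < \<xi>" "\<xi> \<le> r" "0 < T"
    "\<And>\<tau> x. 0 < \<tau> \<Longrightarrow> \<tau> \<le> T \<Longrightarrow> x 0 \<in> ball xbar \<xi> \<Longrightarrow> IGDm f (ball xbar r) \<beta> \<gamma> \<nu> \<tau> x \<Longrightarrow>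
      (\<And>k. k \<ge> 1 \<Longrightarrow> momentum_point \<gamma> x k \<in> ball xbar r \<Longrightarrow>
        gradient f (momentum_point \<gamma> x k) \<noteq> 0) \<Longrightarrow>
      igdm_run f xbar \<beta> \<gamma> r L \<nu> B \<Gamma> a c K R \<rho> t \<epsilon> \<tau> \<phi> x"
proof -
  define a c K where "a = (1 - \<nu> - B\<^sup>2) / 8" "c = (1 - \<nu> + B\<^sup>2) / 2" "K = 2 + L * \<Gamma>"
  have \<Gamma>: "0 \<le> \<Gamma>" using \<gamma>[of 1] by simp
  have a: "0 < a" and K: "0 < K" using B L \<Gamma> by (auto simp: a_c_K_def add_pos_nonneg)
  obtain \<eta> U where \<eta>: "0 < \<eta>" and U: "xbar \<in> interior U" and des: "desingularizing \<eta> \<phi>"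
    and PLK_U: "\<And>y. y \<in> U \<Longrightarrow> f xbar < f y \<Longrightarrow> ereal (f y) < ereal (f xbar) + \<eta> \<Longrightarrow>
      1 \<le> deriv \<phi> (f y - f xbar) * norm (gradient f y)"
    using PLK unfolding PLK_with_def by metis
  obtain R1 where R1: "0 < R1" "ball xbar R1 \<subseteq> U" using U mem_interior by blast
  obtain e where e: "0 < e" "\<And>y. y \<in> ball xbar r \<inter> ball xbar e \<Longrightarrow> f xbar \<le> f y"
    using min unfolding local_minimizer_def by blast
  define R where "R = Min {r, R1, e}"
  define \<rho> where "\<rho> = R / (4 + 2 * \<Gamma>)"
  define \<epsilon> where "\<epsilon> = a * \<rho> / (16 * K)"
  have R: "0 < R" "R \<le> r" "R \<le> R1" "R \<le> e" using r R1 e by (auto simp: R_def)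
  have \<rho>: "0 < \<rho>" "(4 + 2 * \<Gamma>) * \<rho> = R" using R \<Gamma> by (auto simp: \<rho>_def add_pos_nonneg)
  have "1 * \<rho> \<le> (4 + 2 * \<Gamma>) * \<rho>" using \<Gamma> \<rho> by (intro mult_right_mono) auto
  then have \<rho>_le: "\<rho> \<le> R" using \<rho> by simp
  have \<epsilon>: "0 < \<epsilon>" "16 * K * \<epsilon> = a * \<rho>" using a K \<rho> by (auto simp: \<epsilon>_def)
  obtain t0 where t0: "0 < t0" "ereal t0 < \<eta>"
    "\<And>v u. 0 < v \<Longrightarrow> v \<le> u \<Longrightarrow> u \<le> t0 \<Longrightarrow> \<phi> u - \<phi> v \<le> \<epsilon>"
    using desingularizing_small_oscillation[OF des \<eta> \<epsilon>(1)] by blast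
  \<comment> \<open>The entry \<open>\<epsilon>\<^sup>2\<close> ensures
    \<open>sqrt t \<le> \<epsilon>\<close>.\<close>
  define t where "t = min t0 (\<epsilon>\<^sup>2)"
  have t: "0 < t" "sqrt t \<le> \<epsilon>" "t \<le> t0"
    using t0 \<epsilon> by (auto simp: t_def real_le_lsqrt)
  have t\<eta>: "ereal s < \<eta>" if "s \<le> t" for s
    using that t t0 by (intro ereal_le_less_trans[of s t0]) auto
  have slope: "deriv \<phi> s * (u - v) \<le> \<phi> u - \<phi> v" if "0 < v" "v \<le> u" "u \<le> s" "s \<le> t" for v u s
    using desingularizing_slope[OF des that(1-3) t\<eta>[OF that(4)]] .
  have mono: "\<phi> v \<le> \<phi> u" if "0 < v" "v \<le> u" "u \<le> t" for v u
  proof -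
    have "0 < deriv \<phi> u" using des t\<eta>[OF that(3)] that by (auto simp: desingularizing_def)
    then have "0 \<le> deriv \<phi> u * (u - v)" using that by simp
    then show ?thesis using slope[OF that(1,2) order_refl that(3)] by simp
  qed
  have PLK_R: "1 \<le> deriv \<phi> (f y - f xbar) * norm (gradient f y)"
    if "y \<in> ball xbar R" "f xbar < f y" "f y - f xbar \<le> t" for y
  proof (rule PLK_U)
    show "y \<in> U" using that R R1 by auto
    show "ereal (f y) < ereal (f xbar) + \<eta>"
      using t\<eta>[OF that(3)] by (cases \<eta>) auto
  qed fact
  have diff: "f differentiable (at y)" if "y \<in> ball xbar r" for y
    using C1 that by (auto simp: C1_on_def)
  have "isCont f xbar"
    using diff[of xbar] r by (intro differentiable_imp_continuous_within) auto
  then obtain \<xi>0 where \<xi>0: "0 < \<xi>0" "\<And>y. dist y xbar < \<xi>0 \<Longrightarrow> dist (f y) (f xbar) < t"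
    using t unfolding continuous_at_eps_delta by blast
  \<comment> \<open>Continuity at \<open>xbar\<close> makes the initial gap at most
    \<open>t\<close>, and \<open>\<rho> / 2\<close> leaves room for the path length.\<close>
  define \<xi> where "\<xi> = min \<xi>0 (\<rho> / 2)"
  \<comment> \<open>The entry 1 serves \<open>\<tau> \<le> sqrt \<tau>\<close>; the quotient lets
    \<open>a\<close> dominate \<open>\<tau> * (L * (\<Gamma> + 1))\<close>.\<close>
  define T where "T = min 1 (a / (L * (\<Gamma> + 1)))"
  have L\<Gamma>: "0 < L * (\<Gamma> + 1)" using L \<Gamma> by simp
  show ?thesis
  proof
    show "0 < \<xi>" "\<xi> \<le> r" "0 < T"
      using \<xi>0 \<rho> \<rho>_le R a L\<Gamma> by (auto simp: \<xi>_def T_def)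
    fix \<tau> and x :: "nat \<Rightarrow> 'a"
    assume run: "0 < \<tau>" "\<tau> \<le> T" "x 0 \<in> ball xbar \<xi>" "IGDm f (ball xbar r) \<beta> \<gamma> \<nu> \<tau> x"
      and nz: "\<And>k. k \<ge> 1 \<Longrightarrow> momentum_point \<gamma> x k \<in> ball xbar r \<Longrightarrow>
        gradient f (momentum_point \<gamma> x k) \<noteq> 0"
    have \<tau>: "\<tau> \<le> 1" "\<tau> * (L * (\<Gamma> + 1)) \<le> a"
      using run L\<Gamma> by (auto simp: T_def pos_le_divide_eq)
    have x0: "dist xbar (x 0) < \<rho> / 2" "f (x 0) - f xbar \<le> t"
      using run \<xi>0(2)[of "x 0"] by (auto simp: \<xi>_def dist_commute dist_real_def)
    show "igdm_run f xbar \<beta> \<gamma> r L \<nu> B \<Gamma> a c K R \<rho> t \<epsilon> \<tau> \<phi> x"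
    proof
      show "f xbar \<le> f y" if "y \<in> ball xbar R" for y using that R by (intro e) auto
      show "\<phi> u - \<phi> v \<le> \<epsilon>" if "0 < v" "v \<le> u" "u \<le> t" for v u
        using that t by (intro t0) auto
      show "norm (gradient f y - gradient f z) \<le> L * norm (y - z)"
        if "y \<in> ball xbar r" "z \<in> ball xbar r" for y z using lip that by blast
    qed (fact diff L \<nu> B \<beta> \<gamma> a_c_K_def run \<tau> R \<rho>(1) eq_refl[OF \<rho>(2)] PLK_R slope mono \<epsilon>(1)
        t(2) eq_refl[OF \<epsilon>(2)] x0 nz)+
  qed
qed

theorem theorem3p6:
  fixes xbar :: "real ^ 'n" and f :: "real ^ 'n \<Rightarrow> real"
    and r L \<nu> :: real and \<beta> \<gamma> :: "nat \<Rightarrow> real"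
  assumes "0 < r" and "0 < L"
    and "C1_on f (ball xbar r)"
    and "\<forall>x\<in>ball xbar r. \<forall>y\<in>ball xbar r. norm (gradient f x - gradient f y) \<le> L * norm (x - y)"
    and "local_minimizer f (ball xbar r) xbar"
    and "PLK f (ball xbar r) xbar"
    and "0 < \<nu>" and "\<nu> < 1"
    and "\<forall>k\<ge>1. 0 \<le> \<beta> k" and "\<forall>k\<ge>1. 0 \<le> \<gamma> k"
    and "(SUP k\<in>{1..}. ereal (\<beta> k)) < ereal (sqrt (1 - \<nu>))"
    and "(SUP k\<in>{1..}. ereal \<bar>\<beta> k - \<gamma> k\<bar>) < \<infinity>"
  shows "\<forall>q. 0 < q \<and> q < 1 \<longrightarrow>
    (\<exists>\<xi> T. 0 < \<xi> \<and> \<xi> \<le> r \<and> 0 < T \<and>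
      (\<forall>\<tau> x. 0 < \<tau> \<and> \<tau> \<le> T \<and> x 0 \<in> ball xbar \<xi> \<and>
          IGDm f (ball xbar r) \<beta> \<gamma> \<nu> \<tau> x \<and>
          (\<forall>k\<ge>1. momentum_point \<gamma> x k \<in> ball xbar r \<longrightarrow>
              gradient f (momentum_point \<gamma> x k) \<noteq> 0) \<longrightarrow>
        (\<forall>k. x k \<in> ball xbar r) \<and>
        (\<forall>k\<ge>1. momentum_point \<beta> x k \<in> ball xbar r \<and> momentum_point \<gamma> x k \<in> ball xbar r) \<and>
        (\<exists>xt. local_minimizer f (ball xbar r) xt \<and> f xt = f xbar \<and>
          x \<longlonglongrightarrow> xt \<and> momentum_point \<beta> x \<longlonglongrightarrow> xt \<and> momentum_point \<gamma> x \<longlonglongrightarrow> xt \<and>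
          (exponential_PLK f (ball xbar r) xbar q \<longrightarrow>
            (q = 1/2 \<longrightarrow>
              converges_linearly x xt \<and>
              converges_linearly (\<lambda>k. gradient f (x k)) 0 \<and>
              converges_linearly (\<lambda>k. f (x k)) (f xt)) \<and>
            (1/2 < q \<longrightarrow>
              (\<lambda>k. norm (x k - xt)) \<in> O(\<lambda>k. real k powr (- ((1 - q) / (2 * q - 1)))) \<and>
              (\<lambda>k. norm (gradient f (x k))) \<in> O(\<lambda>k. real k powr (- ((1 - q) / (2 * q - 1)))) \<and>
              (\<lambda>k. f (x k) - f xt) \<in> O(\<lambda>k. real k powr (- ((2 - 2 * q) / (2 * q - 1)))))))))"
proof (intro allI impI, goal_cases)
  case q: (1 q)
  let ?X = "ball xbar r"
  \<comment> \<open>A real number strictly between the supremum and the threshold bounds every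
    \<open>\<beta> k\<close> and keeps the strict inequality.\<close>
  obtain B where "(SUP k\<in>{1..}. ereal (\<beta> k)) < ereal B" and B_less: "ereal B < ereal (sqrt (1 - \<nu>))"
    using ereal_dense2[OF assms(11)] by blast
  then have \<beta>: "\<beta> k \<le> B" if "k \<ge> 1" for k
    using SUP_lessD[of "\<lambda>k. ereal (\<beta> k)" "{1..}" "ereal B" k] that by simp
  then have B: "0 \<le> B" using assms(9) order_trans by blast
  then have "B\<^sup>2 < (sqrt (1 - \<nu>))\<^sup>2" using B_less by (intro power_strict_mono) auto
  then have B2: "B\<^sup>2 < 1 - \<nu>" using assms(8) by simp
  obtain \<delta> where "(SUP k\<in>{1..}. ereal \<bar>\<beta> k - \<gamma> k\<bar>) < ereal \<delta>"
    using ereal_dense2[OF assms(12)] by blast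
  then have "\<bar>\<beta> k - \<gamma> k\<bar> < \<delta>" if "k \<ge> 1" for k
    using SUP_lessD[of "\<lambda>k. ereal \<bar>\<beta> k - \<gamma> k\<bar>" "{1..}" "ereal \<delta>" k] that by simp
  \<comment> \<open>The bounds on \<open>\<beta>\<close> and on its distance to
    \<open>\<gamma>\<close> provide \<open>B + \<delta>\<close> in the role of
    \<open>\<Gamma>\<close>.\<close>
  then have \<gamma>: "\<gamma> k \<le> B + \<delta>" if "k \<ge> 1" for k
    using \<beta>[OF that] that by (smt (verit))
  \<comment> \<open>\<open>\<xi>\<close> and \<open>T\<close> depend on \<open>\<phi>\<close>, so
    \<open>\<phi>\<close> is chosen first: an exponential one if it exists for this
    \<open>q\<close>, and an arbitrary desingularizing function otherwise.\<close>
  obtain \<phi> where \<phi>: "PLK_with f ?X xbar \<phi>"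
    "exponential_PLK f ?X xbar q \<Longrightarrow> \<exists>M>0. \<phi> = (\<lambda>t. M * t powr (1 - q))"
    using assms(6) unfolding PLK_def exponential_PLK_def by blast
  obtain \<xi> T a c K R \<rho> t \<epsilon> where \<xi>: "0 < \<xi>" "\<xi> \<le> r" "0 < T"
    and run: "\<And>\<tau> x. 0 < \<tau> \<Longrightarrow> \<tau> \<le> T \<Longrightarrow> x 0 \<in> ball xbar \<xi> \<Longrightarrow> IGDm f ?X \<beta> \<gamma> \<nu> \<tau> x \<Longrightarrow>
      (\<And>k. k \<ge> 1 \<Longrightarrow> momentum_point \<gamma> x k \<in> ?X \<Longrightarrow> gradient f (momentum_point \<gamma> x k) \<noteq> 0) \<Longrightarrow>
      igdm_run f xbar \<beta> \<gamma> r L \<nu> B (B + \<delta>) a c K R \<rho> t \<epsilon> \<tau> \<phi> x"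
    using igdm_run_exists[where \<beta> = \<beta> and \<gamma> = \<gamma>, OF assms(1-5) \<phi>(1) assms(7,8) B B2 _ \<beta> _ \<gamma>]
      assms(9,10) by blast
  show ?case
  proof (rule exI[of _ \<xi>], rule exI[of _ T], intro conjI \<xi>, intro allI impI, goal_cases)
    case (1 \<tau> x)
    then interpret igdm_run f xbar \<beta> \<gamma> r L \<nu> B "B + \<delta>" a c K R \<rho> t \<epsilon> \<tau> \<phi> x
      by (intro run) auto
    obtain z where z: "x \<longlonglongrightarrow> z" by (rule converges)
    show ?case
    proof (intro conjI allI impI exI[of _ z] z local_minimizer_z[OF z] f_z[OF z] momentum_limits[OF z])
      show "x k \<in> ?X" for k
        using near[of k] \<rho>_le \<rho> R by simp
      show "momentum_point \<beta> x k \<in> ?X" "momentum_point \<gamma> x k \<in> ?X" if "k \<ge> 1" for k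
        by (intro in_ball ex_ball near that)+
    next
      assume exp: "exponential_PLK f ?X xbar q"
      obtain M where M: "\<phi> = (\<lambda>t. M * t powr (1 - q))" "0 < M" using \<phi>(2)[OF exp] by blast
      note linear = linear_rate[OF z M] and sublinear = sublinear_rate[OF z M]
      show "converges_linearly x z" "converges_linearly (\<lambda>k. gradient f (x k)) 0"
        "converges_linearly (\<lambda>k. f (x k)) (f z)" if "q = 1 / 2"
        using linear that by auto
      show "(\<lambda>k. norm (x k - z)) \<in> O(\<lambda>k. real k powr (- ((1 - q) / (2 * q - 1))))"
        "(\<lambda>k. norm (gradient f (x k))) \<in> O(\<lambda>k. real k powr (- ((1 - q) / (2 * q - 1))))"
        "(\<lambda>k. f (x k) - f z) \<in> O(\<lambda>k. real k powr (- ((2 - 2 * q) / (2 * q - 1))))" if "1 / 2 < q"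
        using sublinear that q by auto
    qed
  qed
qed

end
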